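(* The $q$-bracket $\langle\,\cdot\,\rangle_q:\mathcal{S}\to\widetilde{M}$ is surjective.
   Context: Partitions $\lambda=(\lambda_1\ge\lambda_2\ge\dots)$, $|\lambda|=\sum\lambda_i$, $\mathscr{P}$ the set of all partitions. For $f:\mathscr{P}\to\mathbb{Q}$, $\langle f\rangle_q=\frac{\sum_\lambda f(\lambda)q^{|\lambda|}}{\sum_\lambda q^{|\lambda|}}$. For even $k\ge2$, $S_k(\lambda)=-\frac{B_k}{2k}+\sum_i\lambda_i^{k-1}$ ($B_k$ Bernoulli numbers); $\mathcal{S}$ is the $\mathbb{Q}$-algebra generated by the $S_k$ under the pointwise product. $\widetilde{M}$ denotes the $\mathbb{Q}$-algebra of quasimodular forms for $\mathrm{SL}_2(\mathbb{Z})$ with rational Fourier coefficients, i.e. $\widetilde{M}=\mathbb{Q}[G_2,G_4,G_6]$ with $G_k=-\frac{B_k}{2k}+\sum_{m,r\ge1}m^{k-1}q^{mr}$. *)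

theory Defs
  imports "HOL-Library.Multiset" "HOL-Computational_Algebra.Formal_Power_Series"
begin

(* Bernoulli numbers B_0, B_1, ... (B_1 = -1/2 convention), via the standard recursion
   sum_{j=0}^{m} binom(m+1,j) B_j = 0 for m >= 1, B_0 = 1.
   bern_list n = [B_0, ..., B_n]. *)
fun bern_list :: "nat \<Rightarrow> rat list" where
  "bern_list 0 = [1]"
| "bern_list (Suc n) = bern_list n @
     [ - (1 / of_nat (n + 2)) * (\<Sum>j\<le>n. of_nat ((n + 2) choose j) * (bern_list n ! j)) ]"

definition bernoulli :: "nat \<Rightarrow> rat" where
  "bernoulli n = bern_list n ! n"

type_synonym partition = "nat multiset"

definition is_partition :: "partition \<Rightarrow> bool" where
  "is_partition la \<longleftrightarrow> (\<forall>p \<in># la. p > 0)"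

definition size_part :: "partition \<Rightarrow> nat" where
  "size_part la = sum_mset la"

definition partitions_of :: "nat \<Rightarrow> partition set" where
  "partitions_of n = {la. is_partition la \<and> size_part la = n}"

definition S_fun :: "nat \<Rightarrow> partition \<Rightarrow> rat" where
  "S_fun k la = - bernoulli k / (2 * of_nat k) + (\<Sum>p \<in># la. of_nat p ^ (k - 1))"

inductive_set S_alg :: "(partition \<Rightarrow> rat) set" where
  const: "(\<lambda>_. c) \<in> S_alg"
| gen: "even k \<Longrightarrow> k \<ge> 2 \<Longrightarrow> S_fun k \<in> S_alg"
| add: "f \<in> S_alg \<Longrightarrow> g \<in> S_alg \<Longrightarrow> (\<lambda>x. f x + g x) \<in> S_alg"
| mult: "f \<in> S_alg \<Longrightarrow> g \<in> S_alg \<Longrightarrow> (\<lambda>x. f x * g x) \<in> S_alg"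

(* q-bracket as a formal power series in q:
   (sum_lambda f(lambda) q^|lambda|) / (sum_lambda q^|lambda|);
   the denominator has constant term 1, hence is invertible. *)
definition qbracket :: "(partition \<Rightarrow> rat) \<Rightarrow> rat fps" where
  "qbracket f =
     Abs_fps (\<lambda>n. \<Sum>la\<in>partitions_of n. f la)
     * inverse (Abs_fps (\<lambda>n. of_nat (card (partitions_of n))))"

definition G :: "nat \<Rightarrow> rat fps" where
  "G k = Abs_fps (\<lambda>n. if n = 0 then - bernoulli k / (2 * of_nat k)
                       else (\<Sum>m | m dvd n. of_nat m ^ (k - 1)))"

inductive_set fps_alg_gen :: "rat fps set \<Rightarrow> rat fps set" for A where
  const: "fps_const c \<in> fps_alg_gen A"
| gen: "a \<in> A \<Longrightarrow> a \<in> fps_alg_gen A"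
| add: "f \<in> fps_alg_gen A \<Longrightarrow> g \<in> fps_alg_gen A \<Longrightarrow> f + g \<in> fps_alg_gen A"
| mult: "f \<in> fps_alg_gen A \<Longrightarrow> g \<in> fps_alg_gen A \<Longrightarrow> f * g \<in> fps_alg_gen A"

(* quasimodular forms with rational coefficients: Q[G_2, G_4, G_6] *)
definition QMF :: "rat fps set" where
  "QMF = fps_alg_gen {G 2, G 4, G 6}"

end

(* The sum of g(p) over the parts p is the sum of g(m) over pairs (m, r), r at most the multiplicity of m; removing r copies
   of m from the partition gives the recursion
     <S_k prod_J S_{k_j}> = sum over A <= J of D^|A| G_{k + sum_A (k_j - 2)} <prod_{J-A} S_{k_j}>,  D = q d/dq.
   Rescale by 2^-(k-2). The heat equation of the theta function (proved by a Liouville-type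
   bijection on the solutions of a x + b y = N) together with G_8 = 120 G_4^2 shows that the
   Z_(2)-lattice spanned by the monomials in the rescaled G_2, G_4, G_6 contains every rescaled G_k
   and that D maps it into its double. So the bracket takes values in quasimodular forms, and modulo 2 it is
   multiplicative on the S_k: in each weight the brackets of the monomials in S_2, S_4, S_6 are given by
   an integral matrix over Z_(2) congruent to the identity modulo 2, hence invertible. *)
theory Submission
  imports Defs
begin

text \<open>The bracket is not multiplicative, and the corrections in the recursion are derivatives
  that again have the full weight, so no evident order of the monomials makes the system triangular.
  Congruence modulo a prime replaces triangularity: it is enough that every correction is even. The
  prime 2 comes from the heat identity, with k running over odd numbers: (n+3)/(n+1) G_(n+2) = 2 D
  G_n + 2 sum binom(n,k) G_(k+1) G_(n+1-k). For even n these binomial coefficients are even and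
  (n+3)/(n+1) is a 2-adic unit. The exponent k - 2 of the scale is additive both in these products
  and in the recursion; after halving and rescaling, a factor 2 stands before G_(n+2), and D G_n
  becomes even. Solved for D G_n the identity needs G_(n+2); solved for G_(n+2) it needs D G_n.
  Weight 8 breaks the circle: once G_8 is a polynomial in the generators, n = 2, 4, 6 give the
  derivatives of G_2, G_4, G_6, and all higher weights follow.\<close>

unbundle fps_syntax

section \<open>Bernoulli numbers\<close>

lemma length_bern_list: "length (bern_list n) = Suc n"
  by (induction n) auto

lemma bern_list_nth: "k \<le> n \<Longrightarrow> bern_list n ! k = bernoulli k"
proof (induction n)
  case 0
  then show ?case by (simp add: bernoulli_def)
next
  case (Suc n)
  show ?case
  proof (cases "k = Suc n")
    case True
    then show ?thesis by (simp add: bernoulli_def)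
  next
    case False
    with Suc show ?thesis by (simp add: nth_append length_bern_list)
  qed
qed

lemma bernoulli_0 [simp]: "bernoulli 0 = 1"
  by (simp add: bernoulli_def)

lemma bernoulli_Suc:
  "bernoulli (Suc n) = - (1 / of_nat (n + 2)) * (\<Sum>j\<le>n. of_nat ((n + 2) choose j) * bernoulli j)"
proof -
  have "bernoulli (Suc n) =
      - (1 / of_nat (n + 2)) * (\<Sum>j\<le>n. of_nat ((n + 2) choose j) * (bern_list n ! j))"
    unfolding bernoulli_def by (simp add: nth_append length_bern_list)
  also have "(\<Sum>j\<le>n. of_nat ((n + 2) choose j) * (bern_list n ! j)) =
      (\<Sum>j\<le>n. of_nat ((n + 2) choose j) * bernoulli j)"
    by (intro sum.cong refl) (simp add: bern_list_nth)
  finally show ?thesis .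
qed

lemma sum_binomial_bernoulli:
  assumes "m \<ge> 2"
  shows "(\<Sum>j<m. of_nat (m choose j) * bernoulli j) = 0"
proof -
  obtain n where n: "m = n + 2" using assms by (metis add.commute le_Suc_ex)
  have s: "{..<m} = insert (Suc n) {..n}" using n by auto
  have c: "(n + 2) choose (Suc n) = n + 2"
    using binomial_Suc_n[of "Suc n"] by simp
  have "(\<Sum>j<m. of_nat (m choose j) * bernoulli j) =
      of_nat (n + 2) * bernoulli (Suc n) + (\<Sum>j\<le>n. of_nat ((n + 2) choose j) * bernoulli j)"
    unfolding s by (subst sum.insert) (use n c in auto)
  also have "\<dots> = 0"
    unfolding bernoulli_Suc by (simp add: field_simps del: of_nat_add)
  finally show ?thesis .
qed

definition bern_fps :: "rat fps" where
  "bern_fps = Abs_fps (\<lambda>k. bernoulli k / fact k)"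

lemma bern_fps_exp: "bern_fps * (fps_exp 1 - 1) = fps_X"
proof (rule fps_ext)
  fix m
  have "(bern_fps * (fps_exp 1 - 1)) $ m =
      (\<Sum>j=0..m. bernoulli j / fact j * (fps_exp 1 - 1) $ (m - j))"
    by (simp add: fps_mult_nth bern_fps_def)
  also have "\<dots> = (\<Sum>j<m. bernoulli j / fact j * (fps_exp 1 - 1) $ (m - j))"
    by (intro sum.mono_neutral_right) auto
  also have "\<dots> = (\<Sum>j<m. of_nat (m choose j) * bernoulli j) / fact m"
    unfolding sum_divide_distrib
    by (intro sum.cong refl) (auto simp: binomial_fact)
  also have "\<dots> = fps_X $ m"
  proof -
    consider "m = 0" | "m = 1" | "m \<ge> 2" by linarith
    then show ?thesis
    proof cases
      case 3 then show ?thesis by (simp add: sum_binomial_bernoulli)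
    qed (auto simp: fps_X_def)
  qed
  finally show "(bern_fps * (fps_exp 1 - 1)) $ m = fps_X $ m" .
qed

lemma fps_exp_minus_1_nz: "fps_exp 1 - 1 \<noteq> (0 :: rat fps)"
proof
  assume "fps_exp 1 - 1 = (0 :: rat fps)"
  then have "(fps_exp 1 - 1 :: rat fps) $ 1 = 0 $ 1" by simp
  then show False by simp
qed

text \<open>The functional equation is differentiated and the factor \<open>fps_exp 1 - 1\<close>
  cancelled. The square in this Riccati equation is the source of the quadratic recursion for
  Bernoulli numbers.\<close>

lemma bern_fps_ode:
  "fps_X * fps_deriv bern_fps = bern_fps - bern_fps * bern_fps - fps_X * bern_fps"
proof -
  let ?b = bern_fps and ?e = "fps_exp (1::rat)"
  have "fps_deriv (?b * (?e - 1)) = fps_deriv fps_X"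
    by (simp only: bern_fps_exp)
  then have d: "fps_deriv ?b * (?e - 1) + ?b * ?e = 1"
    by (simp add: algebra_simps)
  have "(fps_X * fps_deriv ?b - (?b - ?b * ?b - fps_X * ?b)) * (?e - 1) =
      fps_X * (fps_deriv ?b * (?e - 1) + ?b * ?e) - ?b * (?e - 1) + ?b * (?b * (?e - 1)) - fps_X * ?b"
    by (simp add: algebra_simps)
  also have "\<dots> = 0"
    unfolding d bern_fps_exp by (simp add: algebra_simps)
  finally show ?thesis using fps_exp_minus_1_nz by simp
qed

text \<open>This is (t/2) coth(t/2): adding t/2 removes the Bernoulli number of index 1 and leaves
  an even series.\<close>

definition bern_even_fps :: "rat fps" where
  "bern_even_fps = bern_fps + fps_const (1/2) * fps_X"

lemma bern_even_fps_ode: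
  "fps_X * fps_deriv bern_even_fps =
     bern_even_fps - bern_even_fps * bern_even_fps + fps_const (1/4) * fps_X ^ 2"
proof -
  let ?c = "fps_const (1/2 :: rat)"
  have c: "?c + ?c = 1" "?c * ?c = fps_const (1/4)"
    by (simp_all flip: fps_const_1_eq_1)
  have "bern_even_fps - bern_even_fps * bern_even_fps + fps_const (1/4) * fps_X ^ 2 =
      bern_fps - bern_fps * bern_fps - (?c + ?c) * (fps_X * bern_fps) + ?c * fps_X
        + (fps_const (1/4) - ?c * ?c) * fps_X ^ 2"
    unfolding bern_even_fps_def by (simp only: algebra_simps power2_eq_square)
  also have "\<dots> = fps_X * fps_deriv bern_fps + ?c * fps_X"
    unfolding c bern_fps_ode by simp
  also have "\<dots> = fps_X * fps_deriv bern_even_fps"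
    unfolding bern_even_fps_def by (simp add: algebra_simps)
  finally show ?thesis by simp
qed

lemma bernoulli_1: "bernoulli 1 = - 1 / 2"
  using bernoulli_Suc[of 0] by simp

lemma bern_even_fps_nth:
  "bern_even_fps $ m = (if m = 1 then 0 else bernoulli m / fact m)"
  using bernoulli_1 by (auto simp: bern_even_fps_def bern_fps_def fps_X_def)

text \<open>Coefficients of the Riccati equation are compared; the end terms i = 0 and i = m of the
  square move to the left. From m = 3 on the term in \<open>fps_X ^ 2\<close> does not
  interfere.\<close>

lemma bern_even_fps_rec:
  assumes "m \<ge> 3"
  shows "of_nat (m + 1) * bern_even_fps $ m =
    - (\<Sum>i\<in>{0<..<m}. bern_even_fps $ i * bern_even_fps $ (m - i))"
proof -
  let ?h = bern_even_fps
  obtain p where p: "m = Suc p" using assms by (cases m) auto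
  have h0: "?h $ 0 = 1" by (simp add: bern_even_fps_nth)
  have "(fps_X * fps_deriv ?h) $ m = of_nat m * ?h $ m"
    using p by simp
  moreover have "(?h * ?h) $ m = 2 * ?h $ m + (\<Sum>i\<in>{0<..<m}. ?h $ i * ?h $ (m - i))"
  proof -
    have s: "{0..m} = insert 0 (insert m {0<..<m})" using assms by auto
    show ?thesis unfolding fps_mult_nth s
      by (subst sum.insert; (subst sum.insert)?) (use assms h0 in auto)
  qed
  moreover have "(fps_const (1/4) * fps_X ^ 2 :: rat fps) $ m = 0"
    using assms by (simp add: fps_X_power_nth)
  ultimately show ?thesis
    using arg_cong[OF bern_even_fps_ode, of "\<lambda>f. f $ m"] by (simp add: algebra_simps)
qed

text \<open>One of i and m - i is odd, so the quadratic recursion passes the vanishing on from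
  smaller odd indices.\<close>

lemma bern_even_fps_odd: "odd m \<Longrightarrow> bern_even_fps $ m = 0"
proof (induction m rule: less_induct)
  case (less m)
  show ?case
  proof (cases "m = 1")
    case True then show ?thesis by (simp add: bern_even_fps_nth)
  next
    case False
    with less.prems have m: "m \<ge> 3" by (cases m) (auto elim!: oddE)
    have "(\<Sum>i\<in>{0<..<m}. bern_even_fps $ i * bern_even_fps $ (m - i)) = 0"
    proof (intro sum.neutral ballI)
      fix i assume i: "i \<in> {0<..<m}"
      show "bern_even_fps $ i * bern_even_fps $ (m - i) = 0"
      proof (cases "odd i")
        case True then show ?thesis using less.IH[of i] i by simp
      next
        case False
        then have "odd (m - i)" using i less.prems by simp
        then show ?thesis using less.IH[of "m - i"] i by simp
      qed
    qed
    then show ?thesis using bern_even_fps_rec[OF m] by (simp del: of_nat_add)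
  qed
qed

definition eis_const :: "nat \<Rightarrow> rat" where
  "eis_const k = - bernoulli k / (2 * of_nat k)"

lemma bern_even_fps_eis_const:
  "odd k \<Longrightarrow> bern_even_fps $ Suc k = - 2 * eis_const (Suc k) / fact k"
  by (auto simp: bern_even_fps_nth eis_const_def field_simps simp del: of_nat_Suc)

text \<open>Convolutions of Eisenstein series are indexed by the odd exponent k of a divisor sum,
  that is, weight minus one; Bernoulli indices are shifted to match.\<close>

lemma sum_over_odds:
  fixes f :: "nat \<Rightarrow> 'a :: comm_monoid_add"
  assumes "even n" "\<And>i. odd i \<Longrightarrow> f i = 0"
  shows "(\<Sum>i\<in>{0<..n}. f i) = (\<Sum>k | odd k \<and> k \<le> n. f (Suc k))"
proof -
  have "(\<Sum>k | odd k \<and> k \<le> n. f (Suc k)) = (\<Sum>i | even i \<and> 0 < i \<and> i \<le> n. f i)"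
  proof (rule sum.reindex_bij_witness[where i = "\<lambda>i. i - 1" and j = Suc])
    fix a assume a: "a \<in> {k. odd k \<and> k \<le> n}"
    then have "a \<noteq> n" using assms by auto
    then show "Suc a \<in> {i. even i \<and> 0 < i \<and> i \<le> n}" using a by auto
  qed auto
  also have "\<dots> = (\<Sum>i\<in>{0<..n}. f i)"
    by (intro sum.mono_neutral_left) (use assms in auto)
  finally show ?thesis by simp
qed

text \<open>Euler's quadratic recursion for Bernoulli numbers, normalised as the constant
  coefficient of the heat identity.\<close>

lemma eis_const_rec:
  assumes n: "even n" "n \<ge> 2"
  shows "of_nat (n + 3) / of_nat (n + 1) * eis_const (n + 2) =
    2 * (\<Sum>k | odd k \<and> k \<le> n. of_nat (n choose k) * eis_const (Suc k) * eis_const (n + 1 - k))"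
proof -
  let ?h = bern_even_fps
  have "(\<Sum>i\<in>{0<..<n+2}. ?h $ i * ?h $ (n + 2 - i)) = (\<Sum>i\<in>{0<..n}. ?h $ i * ?h $ (n + 2 - i))"
    by (rule sum.mono_neutral_right) (auto simp: bern_even_fps_nth not_le elim!: le_SucE)
  also have "\<dots> = (\<Sum>k | odd k \<and> k \<le> n. ?h $ Suc k * ?h $ (n + 2 - Suc k))"
    by (rule sum_over_odds) (use n bern_even_fps_odd in auto)
  also have "\<dots> = (\<Sum>k | odd k \<and> k \<le> n.
      4 / fact n * (of_nat (n choose k) * eis_const (Suc k) * eis_const (n + 1 - k)))"
  proof (intro sum.cong refl)
    fix k assume k: "k \<in> {k. odd k \<and> k \<le> n}"
    have "n + 2 - Suc k = Suc (n - k)" "n + 1 - k = Suc (n - k)" using k by auto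
    moreover have "odd (n - k)" using k n by auto
    ultimately show "?h $ Suc k * ?h $ (n + 2 - Suc k) =
        4 / fact n * (of_nat (n choose k) * eis_const (Suc k) * eis_const (n + 1 - k))"
      using k by (simp add: bern_even_fps_eis_const binomial_fact field_simps)
  qed
  also have "\<dots> = 4 / fact n *
      (\<Sum>k | odd k \<and> k \<le> n. of_nat (n choose k) * eis_const (Suc k) * eis_const (n + 1 - k))"
    by (simp add: sum_distrib_left)
  finally have s: "(\<Sum>i\<in>{0<..<n+2}. ?h $ i * ?h $ (n + 2 - i)) = \<dots>" .
  have "of_nat (n + 3) * ?h $ (n + 2) = - (\<Sum>i\<in>{0<..<n+2}. ?h $ i * ?h $ (n + 2 - i))"
    using bern_even_fps_rec[of "n + 2"] n by (simp add: numeral_3_eq_3)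
  moreover have "?h $ (n + 2) = - 2 * eis_const (n + 2) / (of_nat (n + 1) * fact n)"
    using bern_even_fps_eis_const[of "n + 1"] n by simp
  ultimately have eq: "of_nat (n + 3) * (- 2 * eis_const (n + 2) / (of_nat (n + 1) * fact n)) = - (4 / fact n *
      (\<Sum>k | odd k \<and> k \<le> n. of_nat (n choose k) * eis_const (Suc k) * eis_const (n + 1 - k)))"
    unfolding s by simp
  have alg: "x \<noteq> 0 \<Longrightarrow> f \<noteq> 0 \<Longrightarrow> y * (- 2 * c / (x * f)) = - (4 / f * t) \<Longrightarrow> y / x * c = 2 * t"
    for x y f c t :: rat
    by (simp add: field_simps)
  have "rat_of_nat (n + 1) \<noteq> 0" by (simp only: of_nat_eq_0_iff)
  then show ?thesis by (rule alg[OF _ fact_nonzero eq])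
qed

section \<open>Sums of powers of consecutive integers\<close>

lemma bern_fps_power_sum:
  "fps_X * (\<Sum>a<d. fps_exp (of_nat a)) = bern_fps * (fps_exp (of_nat d) - 1)"
proof -
  have "(\<Sum>a<d. fps_exp (of_nat a :: rat)) * (fps_exp 1 - 1) = fps_exp (of_nat d) - 1"
    by (induction d) (simp_all add: algebra_simps fps_exp_add_mult)
  then have "fps_X * ((\<Sum>a<d. fps_exp (of_nat a :: rat)) * (fps_exp 1 - 1)) = fps_X * (fps_exp (of_nat d) - 1)"
    by simp
  then have "(fps_X * (\<Sum>a<d. fps_exp (of_nat a :: rat)) - bern_fps * (fps_exp (of_nat d) - 1)) * (fps_exp 1 - 1)
     = fps_X * (fps_exp (of_nat d) - 1) - bern_fps * (fps_exp 1 - 1) * (fps_exp (of_nat d) - 1)"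
    by (simp add: algebra_simps)
  then show ?thesis using fps_exp_minus_1_nz by (simp add: bern_fps_exp)
qed

text \<open>Faulhaber's formula, doubled. Giving the endpoint d half the weight of the other terms
  removes the Bernoulli number of index 1, so that only constants of even weight remain. They will
  cancel the part of the heat identity that is linear in divisor sums.\<close>

lemma faulhaber_even:
  assumes n: "even n" "n \<ge> 2"
  shows "of_nat d ^ n + 2 * (\<Sum>a<d. of_nat a ^ n) =
    2 / of_nat (n + 1) * of_nat d ^ (n + 1)
      - 4 * (\<Sum>k | odd k \<and> k \<le> n. of_nat (n choose k) * eis_const (Suc k) * of_nat d ^ (n - k))"
proof -
  let ?h = bern_even_fps
  have *: "fps_X * ((\<Sum>a<d. fps_exp (of_nat a)) + fps_const (1/2) * (fps_exp (of_nat d) - 1)) =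
      ?h * (fps_exp (of_nat d) - 1)"
    using bern_fps_power_sum[of d] by (simp add: bern_even_fps_def algebra_simps)
  have "(fps_X * ((\<Sum>a<d. fps_exp (of_nat a)) + fps_const (1/2) * (fps_exp (of_nat d) - 1))) $ (Suc n)
      = ((\<Sum>a<d. of_nat a ^ n) + of_nat d ^ n / 2 :: rat) / fact n"
    using n by (simp add: fps_sum_nth sum_divide_distrib add_divide_distrib)
  moreover have "(?h * (fps_exp (of_nat d) - 1)) $ (Suc n) =
      of_nat d ^ Suc n / fact (Suc n) + (\<Sum>i\<in>{0<..n}. ?h $ i * (of_nat d ^ (Suc n - i) / fact (Suc n - i)))"
  proof -
    have s: "{0..Suc n} = insert 0 (insert (Suc n) {0<..n})" by auto
    have "(?h * (fps_exp (of_nat d) - 1)) $ (Suc n) =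
       (?h $ 0 * (fps_exp (of_nat d) - 1) $ Suc n + (\<Sum>i\<in>{0<..n}. ?h $ i * (fps_exp (of_nat d) - 1) $ (Suc n - i)))"
      unfolding fps_mult_nth s by (subst sum.insert; (subst sum.insert)?) auto
    also have "(\<Sum>i\<in>{0<..n}. ?h $ i * (fps_exp (of_nat d) - 1) $ (Suc n - i)) =
       (\<Sum>i\<in>{0<..n}. ?h $ i * (of_nat d ^ (Suc n - i) / fact (Suc n - i)))"
      by (intro sum.cong refl) auto
    moreover have "?h $ 0 = 1" by (simp add: bern_even_fps_nth)
    ultimately show ?thesis by (simp add: algebra_simps)
  qed
  moreover have "(\<Sum>i\<in>{0<..n}. ?h $ i * (of_nat d ^ (Suc n - i) / fact (Suc n - i))) =
     (\<Sum>k | odd k \<and> k \<le> n. ?h $ Suc k * (of_nat d ^ (Suc n - Suc k) / fact (Suc n - Suc k)))"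
    by (rule sum_over_odds) (use n bern_even_fps_odd in auto)
  moreover have "\<dots> = - 2 / fact n * 
      (\<Sum>k | odd k \<and> k \<le> n. of_nat (n choose k) * eis_const (Suc k) * of_nat d ^ (n - k))"
    unfolding sum_distrib_left
    by (intro sum.cong refl) (auto simp: bern_even_fps_eis_const binomial_fact field_simps)
  moreover have "of_nat d ^ Suc n / fact (Suc n) = (of_nat d ^ (n + 1) / (of_nat (n + 1) * fact n) :: rat)"
    by simp
  ultimately have eq: "((\<Sum>a<d. of_nat a ^ n) + of_nat d ^ n / 2 :: rat) / fact n =
      of_nat d ^ (n + 1) / (of_nat (n + 1) * fact n) - 2 / fact n *
      (\<Sum>k | odd k \<and> k \<le> n. of_nat (n choose k) * eis_const (Suc k) * of_nat d ^ (n - k))"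
    using * by simp
  have alg: "x \<noteq> 0 \<Longrightarrow> f \<noteq> 0 \<Longrightarrow> (s + p / 2) / f = e / (x * f) - 2 / f * t \<Longrightarrow>
      p + 2 * s = 2 / x * e - 4 * t" for x f s p e t :: rat
  proof -
    assume a: "x \<noteq> 0" "f \<noteq> 0" "(s + p / 2) / f = e / (x * f) - 2 / f * t"
    then have "s + p / 2 = (e / (x * f) - 2 / f * t) * f" by (simp add: divide_eq_eq)
    also have "\<dots> = e / x - 2 * t" using a by (simp add: field_simps)
    finally show ?thesis by simp
  qed
  have "rat_of_nat (n + 1) \<noteq> 0" by (simp only: of_nat_eq_0_iff)
  then show ?thesis by (rule alg[OF _ fact_nonzero eq])
qed

section \<open>Convolutions of divisor sums\<close>

text \<open>Here a and b stand for divisors and x and y for their cofactors, so sums over this set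
  are coefficients of products of divisor-sum series.\<close>

definition quads :: "nat \<Rightarrow> (nat \<times> nat \<times> nat \<times> nat) set" where
  "quads N = {(a, b, x, y). a > 0 \<and> b > 0 \<and> x > 0 \<and> y > 0 \<and> a * x + b * y = N}"

lemma finite_quads: "finite (quads N)"
proof (rule finite_subset)
  show "quads N \<subseteq> {..N} \<times> {..N} \<times> {..N} \<times> {..N}"
  proof
    fix p assume "p \<in> quads N"
    then obtain a b x y where p: "p = (a, b, x, y)" "a > 0" "b > 0" "x > 0" "y > 0" "a * x + b * y = N"
      by (auto simp: quads_def)
    have "a \<le> a * x" "x \<le> a * x" "b \<le> b * y" "y \<le> b * y" using p by auto
    then have "a \<le> N" "x \<le> N" "b \<le> N" "y \<le> N" using p(6) by linarith+
    then show "p \<in> {..N} \<times> {..N} \<times> {..N} \<times> {..N}" using p(1) by simp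
  qed
qed auto

lemma sum_quads_swap:
  "(\<Sum>(a, b, x, y) | (a, b, x, y) \<in> quads N \<and> P a b x y. f a b) =
   (\<Sum>(a, b, x, y) | (a, b, x, y) \<in> quads N \<and> P b a y x. f b a)"
  by (rule sum.reindex_bij_witness[where i = "\<lambda>(a, b, x, y). (b, a, y, x)" and j = "\<lambda>(a, b, x, y). (b, a, y, x)"])
     (auto simp: quads_def)

text \<open>Exchanging (a, x) with (b, y) identifies the two strict cases. The parameter
  \<open>u\<close> allows the split to be made by divisors or by cofactors.\<close>

lemma sum_quads_trichotomy:
  fixes f :: "nat \<Rightarrow> nat \<Rightarrow> rat" and u :: "nat \<Rightarrow> nat \<Rightarrow> nat"
  assumes "\<And>a b. f a b = f b a"
  shows "(\<Sum>(a, b, x, y) \<in> quads N. f a b) =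
    (\<Sum>(a, b, x, y) | (a, b, x, y) \<in> quads N \<and> u a x = u b y. f a b)
    + 2 * (\<Sum>(a, b, x, y) | (a, b, x, y) \<in> quads N \<and> u a x < u b y. f a b)"
proof -
  let ?S = "\<lambda>P. {(a, b, x, y). (a, b, x, y) \<in> quads N \<and> P (u a x) (u b y)}"
  have fin: "finite (?S P)" for P
    by (rule finite_subset[OF _ finite_quads[of N]]) auto
  have "quads N = ?S (=) \<union> (?S (<) \<union> ?S (>))" by auto
  then have "(\<Sum>(a, b, x, y) \<in> quads N. f a b) =
     (\<Sum>(a, b, x, y) \<in> ?S (=) \<union> (?S (<) \<union> ?S (>)). f a b)" by simp
  also have "\<dots> = (\<Sum>(a, b, x, y) \<in> ?S (=). f a b) + ((\<Sum>(a, b, x, y) \<in> ?S (<). f a b) + (\<Sum>(a, b, x, y) \<in> ?S (>). f a b))"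
    by (subst sum.union_disjoint; (subst sum.union_disjoint)?) (use fin in auto)
  also have "(\<Sum>(a, b, x, y) \<in> ?S (>). f a b) = (\<Sum>(a, b, x, y) \<in> ?S (<). f a b)"
    using sum_quads_swap[where N = N and P = "\<lambda>a b x y. u a x > u b y" and f = f] assms by simp
  finally show ?thesis by (simp only: mult_2)
qed

text \<open>A Liouville-type identity: \<open>(a, b, x, y) \<mapsto> (a, a + b, x - y, y)\<close> preserves \<open>a x + b y\<close> and
  maps the quadruples with \<open>x > y\<close> bijectively to those with \<open>a < b\<close>.\<close>

lemma sum_quads_identity:
  fixes R T :: "nat \<Rightarrow> nat \<Rightarrow> rat"
  assumes R: "\<And>a b. R a b = R b a" and T: "\<And>a b. T a b = T b a"
    and RT: "\<And>a b. R a (a + b) = T a b"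
  shows "(\<Sum>(a, b, x, y) \<in> quads N. T a b - R a b) =
    (\<Sum>(a, b, x, y) | (a, b, x, y) \<in> quads N \<and> x = y. T a b)
    - (\<Sum>(a, b, x, y) | (a, b, x, y) \<in> quads N \<and> a = b. R a b)"
proof -
  have "(\<Sum>(a, b, x, y) | (a, b, x, y) \<in> quads N \<and> a < b. R a b) =
     (\<Sum>(a, b, x, y) | (a, b, x, y) \<in> quads N \<and> y < x. T a b)"
    by (rule sum.reindex_bij_witness[where j = "\<lambda>(a, b, x, y). (a, b - a, x + y, y)"
          and i = "\<lambda>(a, b, x, y). (a, a + b, x - y, y)"])
       (auto simp: quads_def RT[symmetric] algebra_simps nat_diff_split_asm le_iff_add less_iff_Suc_add)
  also have "\<dots> = (\<Sum>(a, b, x, y) | (a, b, x, y) \<in> quads N \<and> x < y. T a b)"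
    using sum_quads_swap[where N = N and P = "\<lambda>a b x y. y < x" and f = T] T by simp
  \<comment> \<open>\<open>R\<close> is split by comparing a with b, \<open>T\<close> by comparing x
    with y. The strict parts agree by the bijection, and only the two diagonals survive.\<close>
  finally show ?thesis
    using sum_quads_trichotomy[of R N "\<lambda>a x. a", OF R] sum_quads_trichotomy[of T N "\<lambda>a x. x", OF T]
    by (simp add: sum_subtractf case_prod_unfold)
qed

text \<open>For a = b the equation is a (x + y) = N, which leaves N / a - 1 choices of x for each
  divisor a.\<close>

lemma sum_quads_diag_left:
  fixes f :: "nat \<Rightarrow> rat"
  assumes "N > 0"
  shows "(\<Sum>(a, b, x, y) | (a, b, x, y) \<in> quads N \<and> a = b. f a) =
     (\<Sum>a | a dvd N. (of_nat (N div a) - 1) * f a)"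
proof -
  have "(\<Sum>(a, b, x, y) | (a, b, x, y) \<in> quads N \<and> a = b. f a) =
     (\<Sum>(a, x) \<in> (SIGMA a:{a. a dvd N}. {0<..<N div a}). f a)"
  proof (rule sum.reindex_bij_witness[where j = "\<lambda>(a, b, x, y). (a, x)"
          and i = "\<lambda>(a, x). (a, a, x, N div a - x)"])
    fix p assume "p \<in> {(a, b, x, y). (a, b, x, y) \<in> quads N \<and> a = b}"
    then obtain a x y where p: "p = (a, a, x, y)" "a > 0" "x > 0" "y > 0" "N = a * (x + y)"
      by (auto simp: quads_def algebra_simps)
    then show "(case case p of (a, b, x, y) \<Rightarrow> (a, x) of (a, x) \<Rightarrow> (a, a, x, N div a - x)) = p"
      "(case p of (a, b, x, y) \<Rightarrow> (a, x)) \<in> (SIGMA a:{a. a dvd N}. {0<..<N div a})" by auto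
  next
    fix p assume "p \<in> (SIGMA a:{a. a dvd N}. {0<..<N div a})"
    then show "(case p of (a, x) \<Rightarrow> (a, a, x, N div a - x)) \<in> {(a, b, x, y). (a, b, x, y) \<in> quads N \<and> a = b}"
      using assms by (auto simp: quads_def simp flip: distrib_left elim!: dvdE)
  qed auto
  also have "\<dots> = (\<Sum>a | a dvd N. \<Sum>x\<in>{0<..<N div a}. f a)"
    by (subst sum.Sigma) (use assms in auto)
  also have "\<dots> = (\<Sum>a | a dvd N. (of_nat (N div a) - 1) * f a)"
  proof (intro sum.cong refl)
    fix a assume "a \<in> {a. a dvd N}"
    then have "N div a > 0" using assms by (auto elim!: dvdE)
    then show "(\<Sum>x\<in>{0<..<N div a}. f a) = (of_nat (N div a) - 1) * f a"
      by (simp add: of_nat_diff)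
  qed
  finally show ?thesis .
qed

text \<open>For x = y the equation is (a + b) x = N, so d = a + b divides N and is cut into two
  positive pieces.\<close>

lemma sum_quads_diag_right:
  fixes f :: "nat \<Rightarrow> nat \<Rightarrow> rat"
  assumes "N > 0"
  shows "(\<Sum>(a, b, x, y) | (a, b, x, y) \<in> quads N \<and> x = y. f a b) =
     (\<Sum>d | d dvd N. \<Sum>a\<in>{0<..<d}. f a (d - a))"
proof -
  have "(\<Sum>(a, b, x, y) | (a, b, x, y) \<in> quads N \<and> x = y. f a b) =
     (\<Sum>(d, a) \<in> (SIGMA d:{d. d dvd N}. {0<..<d}). f a (d - a))"
  proof (rule sum.reindex_bij_witness[where j = "\<lambda>(a, b, x, y). (a + b, a)"
          and i = "\<lambda>(d, a). (a, d - a, N div d, N div d)"])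
    fix p assume "p \<in> {(a, b, x, y). (a, b, x, y) \<in> quads N \<and> x = y}"
    then obtain a b x where p: "p = (a, b, x, x)" "a > 0" "b > 0" "x > 0" "N = (a + b) * x"
      by (auto simp: quads_def algebra_simps)
    then show "(case case p of (a, b, x, y) \<Rightarrow> (a + b, a) of (d, a) \<Rightarrow> (a, d - a, N div d, N div d)) = p"
      "(case p of (a, b, x, y) \<Rightarrow> (a + b, a)) \<in> (SIGMA d:{d. d dvd N}. {0<..<d})" by auto
    show "(case case p of (a, b, x, y) \<Rightarrow> (a + b, a) of (d, a) \<Rightarrow> f a (d - a)) = (case p of (a, b, x, y) \<Rightarrow> f a b)"
      using p by simp
  next
    fix p assume "p \<in> (SIGMA d:{d. d dvd N}. {0<..<d})"
    then show "(case p of (d, a) \<Rightarrow> (a, d - a, N div d, N div d)) \<in> {(a, b, x, y). (a, b, x, y) \<in> quads N \<and> x = y}"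
      using assms by (auto simp: quads_def simp flip: distrib_right elim!: dvdE)
  qed auto
  also have "\<dots> = (\<Sum>d | d dvd N. \<Sum>a\<in>{0<..<d}. f a (d - a))"
    by (subst sum.Sigma) (use assms in \<open>auto intro: finite_subset[of _ "{..N}"] dest: dvd_imp_le\<close>)
  finally show ?thesis .
qed

section \<open>Divisor sums as power series\<close>

definition divsum :: "nat \<Rightarrow> nat \<Rightarrow> rat" where
  "divsum k n = (\<Sum>m | m dvd n. of_nat m ^ k)"

definition divsum_fps :: "nat \<Rightarrow> rat fps" where
  "divsum_fps k = Abs_fps (\<lambda>n. if n = 0 then 0 else divsum k n)"

lemma G_eq: "G k = fps_const (eis_const k) + divsum_fps (k - 1)"
  by (rule fps_ext) (auto simp: G_def eis_const_def divsum_fps_def divsum_def)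

lemma divsum_fps_mult_nth:
  "(divsum_fps k * divsum_fps l) $ N = (\<Sum>(a, b, x, y) \<in> quads N. of_nat a ^ k * of_nat b ^ l)"
proof -
  have "(divsum_fps k * divsum_fps l) $ N = (\<Sum>i\<in>{0..N}. divsum_fps k $ i * divsum_fps l $ (N - i))"
    by (simp add: fps_mult_nth)
  also have "\<dots> = (\<Sum>i\<in>{0<..<N}. divsum_fps k $ i * divsum_fps l $ (N - i))"
    by (intro sum.mono_neutral_right) (auto simp: divsum_fps_def)
  also have "\<dots> = (\<Sum>i\<in>{0<..<N}. \<Sum>(a, b) \<in> {a. a dvd i} \<times> {b. b dvd (N - i)}. of_nat a ^ k * of_nat b ^ l)"
    by (intro sum.cong refl) (auto simp: divsum_fps_def divsum_def sum_product sum.cartesian_product)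
  also have "\<dots> = (\<Sum>(i, a, b) \<in> (SIGMA i:{0<..<N}. {a. a dvd i} \<times> {b. b dvd (N - i)}). of_nat a ^ k * of_nat b ^ l)"
    by (subst sum.Sigma) auto
  also have "\<dots> = (\<Sum>(a, b, x, y) \<in> quads N. of_nat a ^ k * of_nat b ^ l)"
  proof (rule sum.reindex_bij_witness[where i = "\<lambda>(a, b, x, y). (a * x, a, b)"
          and j = "\<lambda>(i, a, b). (a, b, i div a, (N - i) div b)"])
    fix p assume "p \<in> (SIGMA i:{0<..<N}. {a. a dvd i} \<times> {b. b dvd (N - i)})"
    then obtain i a b where p: "p = (i, a, b)" "0 < i" "i < N" "a dvd i" "b dvd (N - i)" by auto
    then have "a > 0" "b > 0" using dvd_pos_nat[of i a] dvd_pos_nat[of "N - i" b] by auto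
    moreover from this have "i div a > 0" "(N - i) div b > 0"
      using p by (auto simp: div_greater_zero_iff dvd_imp_le)
    moreover have "a * (i div a) + b * ((N - i) div b) = N" using p by simp
    ultimately show "(case p of (i, a, b) \<Rightarrow> (a, b, i div a, (N - i) div b)) \<in> quads N"
      using p by (simp add: quads_def)
    show "(case case p of (i, a, b) \<Rightarrow> (a, b, i div a, (N - i) div b) of (a, b, x, y) \<Rightarrow> (a * x, a, b)) = p"
      using p by simp
  qed (auto simp: quads_def)
  finally show ?thesis .
qed

section \<open>The heat identity\<close>

definition qD :: "rat fps \<Rightarrow> rat fps" where
  "qD f = fps_X * fps_deriv f"

lemma qD_nth: "qD f $ n = of_nat n * f $ n"
  unfolding qD_def by (cases n) simp_all

lemma qD_add: "qD (f + g) = qD f + qD g"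
  by (simp add: qD_def algebra_simps)

lemma qD_mult: "qD (f * g) = qD f * g + f * qD g"
  by (simp add: qD_def algebra_simps)

lemma qD_const: "qD (fps_const c) = 0"
  by (simp add: qD_def)

lemma qD_scale: "qD (fps_const c * f) = fps_const c * qD f"
  by (simp add: qD_def)

text \<open>This brings the binomially weighted convolutions of the heat identity into a form to
  which the Liouville-type identity applies.\<close>

lemma odd_binomial_diff:
  assumes "even n"
  shows "(x + y) ^ n - (y - x) ^ n = 2 * (\<Sum>k | odd k \<and> k \<le> n. of_nat (n choose k) * x ^ k * y ^ (n - k :: nat) :: rat)"
proof -
  have "(x + y) ^ n - (y - x) ^ n = (\<Sum>k\<le>n. of_nat (n choose k) * x ^ k * y ^ (n - k) - of_nat (n choose k) * (- x) ^ k * y ^ (n - k))"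
    unfolding sum_subtractf using binomial_ring[of x y n] binomial_ring[of "- x" y n] by simp
  also have "\<dots> = (\<Sum>k | odd k \<and> k \<le> n. of_nat (n choose k) * x ^ k * y ^ (n - k) - of_nat (n choose k) * (- x) ^ k * y ^ (n - k))"
    by (rule sum.mono_neutral_right) (auto simp: power_minus_even)
  also have "\<dots> = 2 * (\<Sum>k | odd k \<and> k \<le> n. of_nat (n choose k) * x ^ k * y ^ (n - k))"
    unfolding sum_distrib_left by (intro sum.cong refl) (auto simp: power_minus_odd)
  finally show ?thesis .
qed

lemma sum_quads_even_power:
  assumes n: "even n" "n \<ge> 2" and N: "N > 0"
  shows "(\<Sum>(a, b, x, y) \<in> quads N. (of_nat a + of_nat b) ^ n - (of_nat b - of_nat a) ^ n :: rat) =
    (\<Sum>d | d dvd N. of_nat d ^ (n + 1) + (of_nat d ^ n + 2 * (\<Sum>a<d. of_nat a ^ n)))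
    - 2 * of_nat N * divsum (n - 1) N"
proof -
  \<comment> \<open>The summand a^n + b^n cancels in \<open>T a b - R a b\<close>, but it makes
    \<open>R a (a + b) = T a b\<close> true: both sides are a^n + b^n + (a + b)^n.\<close>
  define R T :: "nat \<Rightarrow> nat \<Rightarrow> rat" where
    "R = (\<lambda>a b. of_nat a ^ n + of_nat b ^ n + (of_nat b - of_nat a) ^ n)" and
    "T = (\<lambda>a b. of_nat a ^ n + of_nat b ^ n + (of_nat a + of_nat b) ^ n)"
  have comm: "(of_nat b - of_nat a) ^ n = (of_nat a - of_nat b :: rat) ^ n" for a b
    using power_minus_even[OF n(1), of "of_nat a - of_nat b :: rat"] by simp
  have R: "R a b = R b a" and T: "T a b = T b a" and RT: "R a (a + b) = T a b" for a b
    using comm[of a b] by (simp_all add: R_def T_def add.commute)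
  have "(\<Sum>(a, b, x, y) \<in> quads N. (of_nat a + of_nat b) ^ n - (of_nat b - of_nat a) ^ n :: rat) =
      (\<Sum>(a, b, x, y) \<in> quads N. T a b - R a b)"
    by (simp add: R_def T_def)
  also have "\<dots> = (\<Sum>(a, b, x, y) | (a, b, x, y) \<in> quads N \<and> x = y. T a b)
    - (\<Sum>(a, b, x, y) | (a, b, x, y) \<in> quads N \<and> a = b. R a b)"
    by (rule sum_quads_identity[OF R T RT])
  also have "(\<Sum>(a, b, x, y) | (a, b, x, y) \<in> quads N \<and> a = b. R a b) =
      (\<Sum>(a, b, x, y) | (a, b, x, y) \<in> quads N \<and> a = b. R a a)"
    by (intro sum.cong refl) auto
  also have "\<dots> = (\<Sum>a | a dvd N. (of_nat (N div a) - 1) * R a a)"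
    by (rule sum_quads_diag_left[OF N])
  \<comment> \<open>Since (N / a) a^n = N a^(n-1), this diagonal carries a factor N; it becomes the
    derivative of \<open>G n\<close>.\<close>
  also have "\<dots> = (\<Sum>a | a dvd N. 2 * of_nat N * of_nat a ^ (n - 1) - 2 * of_nat a ^ n)"
  proof (intro sum.cong refl)
    fix a assume "a \<in> {a. a dvd N}"
    then have "rat_of_nat (N div a) * of_nat a = of_nat N"
      by (metis dvd_div_mult_self mem_Collect_eq of_nat_mult)
    moreover have "rat_of_nat a ^ n = of_nat a * of_nat a ^ (n - 1)"
      using n by (cases n) auto
    moreover have "R a a = 2 * of_nat a ^ n" using n by (simp add: R_def power_0_left)
    ultimately show "(of_nat (N div a) - 1) * R a a = 2 * of_nat N * of_nat a ^ (n - 1) - 2 * of_nat a ^ n"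
      by (simp add: algebra_simps)
  qed
  also have "\<dots> = 2 * of_nat N * divsum (n - 1) N - 2 * (\<Sum>d | d dvd N. of_nat d ^ n)"
    by (simp add: sum_subtractf sum_distrib_left divsum_def)
  also have "(\<Sum>(a, b, x, y) | (a, b, x, y) \<in> quads N \<and> x = y. T a b) =
      (\<Sum>d | d dvd N. \<Sum>a\<in>{0<..<d}. T a (d - a))"
    by (rule sum_quads_diag_right[OF N])
  also have "\<dots> = (\<Sum>d | d dvd N. (of_nat d - 1) * of_nat d ^ n + 2 * (\<Sum>a<d. of_nat a ^ n))"
  proof (intro sum.cong refl)
    fix d assume "d \<in> {d. d dvd N}"
    then have d: "d > 0" using N by (auto intro: dvd_pos_nat)
    have "(\<Sum>a\<in>{0<..<d}. T a (d - a)) =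
        (\<Sum>a\<in>{0<..<d}. of_nat a ^ n) + (\<Sum>a\<in>{0<..<d}. of_nat (d - a) ^ n) + (\<Sum>a\<in>{0<..<d}. of_nat d ^ n)"
      unfolding sum.distrib[symmetric] by (intro sum.cong refl) (auto simp: T_def of_nat_diff)
    also have "(\<Sum>a\<in>{0<..<d}. of_nat (d - a) ^ n) = (\<Sum>a\<in>{0<..<d}. of_nat a ^ n :: rat)"
      by (rule sum.reindex_bij_witness[where i = "\<lambda>a. d - a" and j = "\<lambda>a. d - a"]) auto
    also have "(\<Sum>a\<in>{0<..<d}. of_nat a ^ n) = (\<Sum>a<d. of_nat a ^ n :: rat)"
      by (rule sum.mono_neutral_left) (use n in auto)
    also have "(\<Sum>a\<in>{0<..<d}. of_nat d ^ n) = (of_nat d - 1) * (of_nat d ^ n :: rat)"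
      using d by (simp add: of_nat_diff)
    finally show "(\<Sum>a\<in>{0<..<d}. T a (d - a)) = (of_nat d - 1) * of_nat d ^ n + 2 * (\<Sum>a<d. of_nat a ^ n)"
      by simp
  qed
  finally show ?thesis
    by (simp add: sum.distrib sum_subtractf sum_distrib_left[symmetric] algebra_simps case_prod_unfold)
qed

text \<open>This is the coefficient of z^n / n! in the heat equation for the logarithm of the Jacobi
  theta function. Here it is checked coefficientwise: N = 0 is Euler's recursion, and for N > 0 the
  Liouville-type identity evaluates the convolutions.\<close>

lemma heat_identity:
  assumes n: "even n" "n \<ge> 2"
  shows "fps_const (of_nat (n + 3) / of_nat (n + 1)) * G (n + 2) = 2 * qD (G n) +
     2 * (\<Sum>k | odd k \<and> k \<le> n. of_nat (n choose k) * (G (Suc k) * G (n + 1 - k)))"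
proof (rule fps_ext)
  fix N
  let ?O = "{k. odd k \<and> k \<le> n}"
  let ?c = "\<lambda>k. rat_of_nat (n choose k)"
  let ?e = eis_const
  have ind: "n - (n - k) = k" "odd (n - k)" "n - k \<le> n" if "k \<in> ?O" for k using that n by auto
  have of_nat_nth: "(of_nat m * f) $ i = of_nat m * f $ i" for m i and f :: "rat fps"
    by (simp flip: fps_of_nat)
  have two_nth: "(2 * f) $ i = 2 * f $ i" for i and f :: "rat fps"
    using of_nat_nth[of 2] by simp
  have rhs: "(2 * qD (G n) + 2 * (\<Sum>k\<in>?O. of_nat (n choose k) * (G (Suc k) * G (n + 1 - k)))) $ N
     = 2 * (of_nat N * G n $ N) + 2 * (\<Sum>k\<in>?O. ?c k * (G (Suc k) * G (n + 1 - k)) $ N)"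
    by (simp add: two_nth qD_nth fps_sum_nth of_nat_nth)
  show "(fps_const (of_nat (n + 3) / of_nat (n + 1)) * G (n + 2)) $ N = (2 * qD (G n) +
     2 * (\<Sum>k\<in>?O. of_nat (n choose k) * (G (Suc k) * G (n + 1 - k)))) $ N"
  proof (cases "N = 0")
    case True
    then show ?thesis unfolding rhs using eis_const_rec[OF n]
      by (simp add: G_eq divsum_fps_def mult.assoc)
  next
    case False
    then have N: "N > 0" by simp
    let ?conv = "\<lambda>k. (divsum_fps k * divsum_fps (n - k)) $ N"
    have G_nth: "G (Suc k) $ N = divsum k N" for k
      using N by (simp add: G_eq divsum_fps_def)
    have "(G (Suc k) * G (n + 1 - k)) $ N =
        ?e (Suc k) * divsum (n - k) N + ?e (Suc (n - k)) * divsum k N + ?conv k" if "k \<in> ?O" for k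
      using N that by (simp add: G_eq Suc_diff_le algebra_simps divsum_fps_def[THEN arg_cong[where f = "\<lambda>f. f $ N"]])
    then have "2 * (\<Sum>k\<in>?O. ?c k * (G (Suc k) * G (n + 1 - k)) $ N) =
        2 * (\<Sum>k\<in>?O. ?c k * ?e (Suc k) * divsum (n - k) N) +
        2 * (\<Sum>k\<in>?O. ?c k * ?e (Suc (n - k)) * divsum k N) + 2 * (\<Sum>k\<in>?O. ?c k * ?conv k)"
      by (simp add: sum.distrib distrib_left mult.assoc)
    \<comment> \<open>The reflection of k to n - k equates the two mixed sums. Together they have
      coefficient 4, which the -4 of Faulhaber's formula cancels.\<close>
    also have "(\<Sum>k\<in>?O. ?c k * ?e (Suc (n - k)) * divsum k N) = (\<Sum>k\<in>?O. ?c k * ?e (Suc k) * divsum (n - k) N)"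
      by (rule sum.reindex_bij_witness[where i = "\<lambda>k. n - k" and j = "\<lambda>k. n - k"])
         (use ind in \<open>auto simp: binomial_symmetric[symmetric]\<close>)
    also have "2 * (\<Sum>k\<in>?O. ?c k * ?conv k) =
        (\<Sum>(a, b, x, y) \<in> quads N. (of_nat a + of_nat b) ^ n - (of_nat b - of_nat a) ^ n :: rat)"
      unfolding odd_binomial_diff[OF n(1)] divsum_fps_mult_nth sum_distrib_left
      by (subst sum.swap) (simp add: case_prod_unfold mult.assoc)
    also have "\<dots> = (\<Sum>d | d dvd N. of_nat d ^ (n + 1) + (of_nat d ^ n + 2 * (\<Sum>a<d. of_nat a ^ n)))
        - 2 * of_nat N * divsum (n - 1) N"
      by (rule sum_quads_even_power[OF n N])
    also have "(\<Sum>d | d dvd N. of_nat d ^ (n + 1) + (of_nat d ^ n + 2 * (\<Sum>a<d. of_nat a ^ n))) =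
        divsum (n + 1) N + 2 / of_nat (n + 1) * divsum (n + 1) N
          - 4 * (\<Sum>k\<in>?O. ?c k * ?e (Suc k) * divsum (n - k) N)"
    proof -
      have "(\<Sum>k\<in>?O. ?c k * ?e (Suc k) * divsum (n - k) N) = (\<Sum>d | d dvd N. \<Sum>k\<in>?O. ?c k * ?e (Suc k) * of_nat d ^ (n - k))"
        unfolding divsum_def sum_distrib_left by (rule sum.swap)
      then show ?thesis
        unfolding faulhaber_even[OF n] divsum_def
        by (simp add: sum.distrib sum_subtractf sum_distrib_left)
    qed
    finally have "2 * (of_nat N * G n $ N) + 2 * (\<Sum>k\<in>?O. ?c k * (G (Suc k) * G (n + 1 - k)) $ N) =
        (1 + 2 / of_nat (n + 1)) * divsum (n + 1) N"
      using G_nth[of "n - 1"] n by (simp add: algebra_simps)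
    also have "1 + 2 / of_nat (n + 1) = (of_nat (n + 3) / of_nat (n + 1) :: rat)"
    proof -
      have "rat_of_nat (n + 1) \<noteq> 0" by (simp only: of_nat_eq_0_iff)
      then show ?thesis by (simp add: field_simps)
    qed
    finally show ?thesis unfolding rhs using G_nth[of "n + 1"] by simp
  qed
qed

section \<open>The relation between the Eisenstein series of weights 4 and 8\<close>

lemma sum_square_mult_complement:
  "(\<Sum>a<d. (of_nat a * (of_nat d - of_nat a))\<^sup>2) = (of_nat d ^ 5 - of_nat d) / (30 :: rat)"
proof -
  \<comment> \<open>The parameter x is separated from the upper bound m to permit induction on m.
    The three terms are x^2 times the sum of squares, -2 x times the sum of cubes, and the sum of
    fourth powers.\<close>
  have *: "(\<Sum>a<m. (of_nat a * (x - of_nat a))\<^sup>2) =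
      x\<^sup>2 * (of_nat m - 1) * of_nat m * (2 * of_nat m - 1) / 6 - x * (of_nat m * (of_nat m - 1))\<^sup>2 / 2
      + of_nat m * (of_nat m - 1) * (2 * of_nat m - 1) * (3 * (of_nat m)\<^sup>2 - 3 * of_nat m - 1) / 30" for m and x :: rat
    by (induction m) (simp_all add: field_simps power2_eq_square)
  show ?thesis unfolding * by (simp add: field_simps power2_eq_square power_numeral_reduce)
qed

lemma bernoulli_values:
  "bernoulli 2 = 1 / 6" "bernoulli 4 = - 1 / 30" "bernoulli 6 = 1 / 42" "bernoulli 8 = - 1 / 30"
  by code_simp+

lemma G8_eq: "G 8 = 120 * (G 4 * G 4)"
proof (rule fps_ext)
  fix N
  have 120: "(120 * f) $ i = 120 * f $ i" for i and f :: "rat fps"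
    by (simp add: numeral_fps_const)
  show "G 8 $ N = (120 * (G 4 * G 4)) $ N"
  proof (cases "N = 0")
    case True
    then show ?thesis unfolding 120 by (simp add: G_eq divsum_fps_def eis_const_def bernoulli_values)
  next
    case False
    then have N: "N > 0" by simp
    \<comment> \<open>Again \<open>R a (a + b) = T a b\<close>. The difference
      \<open>T a b - R a b\<close> is 4 a^3 b^3, the summand of the convolution, and
      \<open>R\<close> vanishes on the diagonal a = b.\<close>
    define R T :: "nat \<Rightarrow> nat \<Rightarrow> rat" where
      "R = (\<lambda>a b. (of_nat a * of_nat b * (of_nat b - of_nat a))\<^sup>2)" and
      "T = (\<lambda>a b. (of_nat a * of_nat b * (of_nat a + of_nat b))\<^sup>2)"
    have R: "R a b = R b a" and T: "T a b = T b a" and RT: "R a (a + b) = T a b" for a b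
      by (simp_all add: R_def T_def power2_eq_square algebra_simps)
    have "4 * (divsum_fps 3 * divsum_fps 3) $ N = (\<Sum>(a, b, x, y) \<in> quads N. T a b - R a b)"
      unfolding divsum_fps_mult_nth sum_distrib_left
      by (intro sum.cong refl) (auto simp: R_def T_def algebra_simps power2_eq_square power3_eq_cube)
    also have "\<dots> = (\<Sum>(a, b, x, y) | (a, b, x, y) \<in> quads N \<and> x = y. T a b)
      - (\<Sum>(a, b, x, y) | (a, b, x, y) \<in> quads N \<and> a = b. R a b)"
      by (rule sum_quads_identity[OF R T RT])
    also have "(\<Sum>(a, b, x, y) | (a, b, x, y) \<in> quads N \<and> a = b. R a b) = 0"
      by (intro sum.neutral) (auto simp: R_def)
    also have "(\<Sum>(a, b, x, y) | (a, b, x, y) \<in> quads N \<and> x = y. T a b) =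
        (\<Sum>d | d dvd N. \<Sum>a\<in>{0<..<d}. T a (d - a))"
      by (rule sum_quads_diag_right[OF N])
    also have "\<dots> = (\<Sum>d | d dvd N. of_nat d ^ 2 * (\<Sum>a<d. (of_nat a * (of_nat d - of_nat a))\<^sup>2))"
    proof (intro sum.cong refl)
      fix d assume "d \<in> {d. d dvd N}"
      have "(\<Sum>a\<in>{0<..<d}. T a (d - a)) =
          (\<Sum>a\<in>{0<..<d}. of_nat d ^ 2 * (of_nat a * (of_nat d - of_nat a))\<^sup>2)"
        by (intro sum.cong refl) (auto simp: T_def of_nat_diff power_mult_distrib)
      also have "\<dots> = (\<Sum>a<d. of_nat d ^ 2 * (of_nat a * (of_nat d - of_nat a))\<^sup>2)"
        by (rule sum.mono_neutral_left) auto
      finally show "(\<Sum>a\<in>{0<..<d}. T a (d - a)) =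
          of_nat d ^ 2 * (\<Sum>a<d. (of_nat a * (of_nat d - of_nat a))\<^sup>2)"
        by (simp add: sum_distrib_left)
    qed
    also have "\<dots> = (divsum 7 N - divsum 3 N) / 30"
      unfolding sum_square_mult_complement divsum_def sum_subtractf[symmetric] sum_divide_distrib
      by (intro sum.cong refl) (simp add: field_simps power_numeral_reduce)
    finally have "(divsum_fps 3 * divsum_fps 3) $ N = (divsum 7 N - divsum 3 N) / 120" by simp
    moreover have "(G 4 * G 4) $ N = 2 * eis_const 4 * divsum 3 N + (divsum_fps 3 * divsum_fps 3) $ N"
      using N by (simp add: G_eq distrib_left distrib_right numeral_fps_const divsum_fps_def[THEN arg_cong[where f = "\<lambda>f. f $ N"]])
    moreover have "G 8 $ N = divsum 7 N"
      using N by (simp add: G_eq divsum_fps_def)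
    ultimately show ?thesis unfolding 120
      by (simp add: eis_const_def bernoulli_values)
  qed
qed

section \<open>The 2-integral lattice of quasimodular forms\<close>

definition two_integral :: "rat set" where
  "two_integral = {x. \<exists>a b. odd b \<and> x = of_int a / of_int b}"

lemma two_integralI: "odd b \<Longrightarrow> of_int a / of_int b \<in> two_integral"
  by (auto simp: two_integral_def)

lemma two_integral_of_int: "of_int a \<in> two_integral"
  using two_integralI[of 1 a] by simp

lemma two_integral_of_nat: "of_nat a \<in> two_integral"
  using two_integral_of_int[of "int a"] by simp

lemma two_integral_divide_of_nat: "odd b \<Longrightarrow> of_nat a / of_nat b \<in> two_integral"
  using two_integralI[of "int b" "int a"] by simp

lemma two_integral_add:
  assumes "x \<in> two_integral" "y \<in> two_integral"
  shows "x + y \<in> two_integral"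
proof -
  obtain a b c d where "odd b" "x = of_int a / of_int b" "odd d" "y = of_int c / of_int d"
    using assms by (auto simp: two_integral_def)
  moreover from this have "b \<noteq> 0" "d \<noteq> 0" by auto
  ultimately have "odd (b * d)" "x + y = of_int (a * d + c * b) / of_int (b * d)"
    by (auto simp: field_simps)
  then show ?thesis using two_integralI by metis
qed

lemma two_integral_mult:
  assumes "x \<in> two_integral" "y \<in> two_integral"
  shows "x * y \<in> two_integral"
proof -
  obtain a b c d where "odd b" "x = of_int a / of_int b" "odd d" "y = of_int c / of_int d"
    using assms by (auto simp: two_integral_def)
  then have "odd (b * d)" "x * y = of_int (a * c) / of_int (b * d)" by auto
  then show ?thesis using two_integralI by metis
qed

lemma two_integral_uminus: "x \<in> two_integral \<Longrightarrow> - x \<in> two_integral"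
  using two_integral_mult[of "of_int (-1)" x] two_integral_of_int[of "-1"] by simp

text \<open>For x = a / b with b odd, the numerator b + 2 a of 1 + 2 x is odd.\<close>

lemma two_integral_unit:
  assumes "x \<in> two_integral"
  shows "1 + 2 * x \<noteq> 0" "1 / (1 + 2 * x) \<in> two_integral"
proof -
  obtain a b where *: "odd b" "x = of_int a / of_int b"
    using assms by (auto simp: two_integral_def)
  have b: "b \<noteq> 0" "b + 2 * a \<noteq> 0" "odd (b + 2 * a)" using * by presburger+
  then have x: "1 + 2 * x = of_int (b + 2 * a) / of_int b"
    using * by (simp add: field_simps)
  show "1 + 2 * x \<noteq> 0" unfolding x using b by (simp only: divide_eq_0_iff of_int_eq_0_iff) simp
  have "1 / (1 + 2 * x) = of_int b / of_int (b + 2 * a)" unfolding x by simp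
  then show "1 / (1 + 2 * x) \<in> two_integral" using two_integralI[OF b(3)] by metis
qed

text \<open>A matrix congruent to the identity modulo 2 is invertible, by Gaussian elimination:
  the pivots stay odd and the entries off the diagonal stay even.\<close>

lemma odd_system_solvable:
  fixes e :: "'i \<Rightarrow> rat fps" and c :: "'i \<Rightarrow> 'i \<Rightarrow> rat" and V :: "rat fps set"
  assumes V_add: "\<And>f g. f \<in> V \<Longrightarrow> g \<in> V \<Longrightarrow> f + g \<in> V"
    and V_scale: "\<And>r f. f \<in> V \<Longrightarrow> fps_const r * f \<in> V"
    and "finite I" "\<And>i j. i \<in> I \<Longrightarrow> j \<in> I \<Longrightarrow> c i j \<in> two_integral"
    and "\<And>i. i \<in> I \<Longrightarrow> e i + (\<Sum>j\<in>I. fps_const (2 * c i j) * e j) \<in> V"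
    and "i \<in> I"
  shows "e i \<in> V"
  using assms(3-)
proof (induction I arbitrary: c i rule: finite_induct)
  case empty
  then show ?case by simp
next
  case (insert p I)
  note c = insert.prems(1) and v = insert.prems(2)
  let ?v = "\<lambda>i. e i + (\<Sum>j\<in>insert p I. fps_const (2 * c i j) * e j)"
  define u where "u = 1 + 2 * c p p"
  have u: "u \<noteq> 0" "1 / u \<in> two_integral"
    using two_integral_unit[OF c[of p p]] by (auto simp: u_def)
  have vp: "?v p = fps_const u * e p + (\<Sum>j\<in>I. fps_const (2 * c p j) * e j)"
    using insert.hyps by (simp add: u_def algebra_simps flip: fps_const_add)
  have IH: "e i \<in> V" if i: "i \<in> I" for i
  \<comment> \<open>Clearing column p subtracts 2 c_ip / u times row p, whose entries are 2 c_pj.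
    The new entry is again twice an element of Z_(2), since the pivot u is a unit there.\<close>
  proof (rule insert.IH[where c = "\<lambda>i j. c i j + - (c i p * (1 / u) * (of_nat 2 * c p j))"])
    fix i j assume "i \<in> I" "j \<in> I"
    then show "c i j + - (c i p * (1 / u) * (of_nat 2 * c p j)) \<in> two_integral"
      using c u by (intro two_integral_add two_integral_mult two_integral_uminus two_integral_of_nat) auto
  next
    fix i assume i: "i \<in> I"
    have "?v i + fps_const (- (2 * c i p / u)) * ?v p \<in> V"
      using i by (intro V_add V_scale v) auto
    also have "?v i + fps_const (- (2 * c i p / u)) * ?v p =
      e i + (\<Sum>j\<in>I. fps_const (2 * (c i j + - (c i p * (1 / u) * (of_nat 2 * c p j)))) * e j)"
    proof -
      have 1: "fps_const (- (2 * c i p / u)) * (fps_const u * e p) = - (fps_const (2 * c i p) * e p)"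
        using u by (simp flip: mult.assoc fps_const_neg)
      have 2: "(\<Sum>j\<in>I. fps_const (2 * (c i j + - (c i p * (1 / u) * (of_nat 2 * c p j)))) * e j) =
         (\<Sum>j\<in>I. fps_const (2 * c i j) * e j) + fps_const (- (2 * c i p / u)) * (\<Sum>j\<in>I. fps_const (2 * c p j) * e j)"
        unfolding sum_distrib_left sum.distrib[symmetric]
      proof (intro sum.cong refl)
        fix j
        have *: "2 * (c i j + - (c i p * (1 / u) * (of_nat 2 * c p j))) = 2 * c i j + - (2 * c i p / u) * (2 * c p j)"
          by (simp add: algebra_simps)
        show "fps_const (2 * (c i j + - (c i p * (1 / u) * (of_nat 2 * c p j)))) * e j =
            fps_const (2 * c i j) * e j + fps_const (- (2 * c i p / u)) * (fps_const (2 * c p j) * e j)"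
          unfolding * fps_const_add[symmetric] distrib_right by (simp only: fps_const_mult[symmetric] mult.assoc)
      qed
      have "?v i + fps_const (- (2 * c i p / u)) * ?v p =
          e i + ((\<Sum>j\<in>I. fps_const (2 * c i j) * e j) + fps_const (- (2 * c i p / u)) * (\<Sum>j\<in>I. fps_const (2 * c p j) * e j))"
        unfolding vp distrib_left 1 using insert.hyps by simp
      then show ?thesis by (simp only: 2)
    qed
    finally show "e i + (\<Sum>j\<in>I. fps_const (2 * (c i j + - (c i p * (1 / u) * (of_nat 2 * c p j)))) * e j) \<in> V" .
  qed (rule i)
  have V0: "0 \<in> V" using V_scale[OF v[of p], of 0] by simp
  have V_sum: "(\<Sum>j\<in>J. f j) \<in> V" if "\<And>j. j \<in> J \<Longrightarrow> f j \<in> V" for J and f :: "'i \<Rightarrow> rat fps"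
    using that by (induction J rule: infinite_finite_induct) (auto intro: V0 V_add)
  \<comment> \<open>Back substitution: the unknowns in \<open>I\<close> already lie in
    \<open>V\<close>, and removing them from row p leaves u times the last one.\<close>
  have "?v p + (\<Sum>j\<in>I. fps_const (- (2 * c p j)) * e j) \<in> V"
    by (intro V_add V_sum V_scale IH v) auto
  also have "?v p + (\<Sum>j\<in>I. fps_const (- (2 * c p j)) * e j) = fps_const u * e p"
    unfolding vp by (simp add: sum.distrib[symmetric] add.assoc flip: distrib_right)
  finally have "fps_const (1 / u) * (fps_const u * e p) \<in> V" by (rule V_scale)
  then have "e p \<in> V" using u by (simp flip: mult.assoc)
  then show ?case using IH insert.prems(3) by auto
qed

text \<open>Scaling \<open>G k\<close> by \<open>2^-(k-2)\<close> makes \<open>q d/dq\<close> vanish modulo 2 on the lattice \<open>lat\<close> below.\<close>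

definition sG :: "nat \<Rightarrow> rat fps" where
  "sG k = fps_const (1 / 2 ^ (k - 2)) * G k"

definition emon :: "nat \<times> nat \<times> nat \<Rightarrow> rat fps" where
  "emon = (\<lambda>(a, b, c). sG 2 ^ a * sG 4 ^ b * sG 6 ^ c)"

definition ewt :: "nat \<times> nat \<times> nat \<Rightarrow> nat" where
  "ewt = (\<lambda>(a, b, c). 2 * a + 4 * b + 6 * c)"

text \<open>Scalars are restricted to Z_(2): over the rationals every element would be twice
  another, and congruences modulo 2 would say nothing.\<close>

inductive_set lat :: "nat \<Rightarrow> rat fps set" for w where
  zero: "0 \<in> lat w"
| emon: "ewt m = w \<Longrightarrow> emon m \<in> lat w"
| add: "f \<in> lat w \<Longrightarrow> g \<in> lat w \<Longrightarrow> f + g \<in> lat w"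
| scale: "r \<in> two_integral \<Longrightarrow> f \<in> lat w \<Longrightarrow> fps_const r * f \<in> lat w"

lemma lat_sum: "(\<And>i. i \<in> I \<Longrightarrow> f i \<in> lat w) \<Longrightarrow> (\<Sum>i\<in>I. f i) \<in> lat w"
  by (induction I rule: infinite_finite_induct) (auto intro: lat.zero lat.add)

lemma lat_diff: "f \<in> lat w \<Longrightarrow> g \<in> lat w \<Longrightarrow> f - g \<in> lat w"
  using lat.add[OF _ lat.scale[of "- 1"], of f w g] two_integral_of_int[of "- 1"]
  by (simp flip: fps_const_neg)

lemma emon_mult: "emon m * emon m' = emon (fst m + fst m', fst (snd m) + fst (snd m'), snd (snd m) + snd (snd m'))"
  by (simp add: emon_def case_prod_unfold power_add algebra_simps)

lemma lat_mult:
  assumes "f \<in> lat v" "g \<in> lat w"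
  shows "f * g \<in> lat (v + w)"
  using assms
proof (induction rule: lat.induct)
  case (emon m)
  from emon(2) show ?case
  proof (induction rule: lat.induct)
    case (emon m')
    then show ?case unfolding emon_mult
      by (intro lat.emon) (use \<open>ewt m = v\<close> in \<open>auto simp: ewt_def case_prod_unfold\<close>)
  next
    case (scale r f)
    then show ?case using lat.scale[of r "emon m * f"] by (simp add: algebra_simps)
  qed (auto simp: distrib_left intro: lat.zero lat.add)
next
  case (scale r f)
  then show ?case using lat.scale[of r "f * g"] by (simp add: algebra_simps)
qed (auto simp: distrib_right intro: lat.zero lat.add)

lemma lat_one: "1 \<in> lat 0"
  using lat.emon[of "(0, 0, 0)" 0] by (simp add: emon_def ewt_def)

text \<open>Membership and evenness of the derivative are bundled because the product rule
  multiplies the derivative of one factor by the other factor itself.\<close>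

definition lat_deriv :: "nat \<Rightarrow> rat fps \<Rightarrow> bool" where
  "lat_deriv w f \<longleftrightarrow> f \<in> lat w \<and> (\<exists>g\<in>lat (w + 2). qD f = fps_const 2 * g)"

lemma lat_deriv_mult:
  assumes "lat_deriv v f" "lat_deriv w g"
  shows "lat_deriv (v + w) (f * g)"
proof -
  obtain f' g' where *: "f \<in> lat v" "g \<in> lat w" "f' \<in> lat (v + 2)" "g' \<in> lat (w + 2)"
    "qD f = fps_const 2 * f'" "qD g = fps_const 2 * g'"
    using assms by (auto simp: lat_deriv_def)
  have "f' * g + f * g' \<in> lat (v + w + 2)"
    using lat_mult[OF *(3,2)] lat_mult[OF *(1,4)] by (intro lat.add) (simp_all add: algebra_simps)
  moreover have "qD (f * g) = fps_const 2 * (f' * g + f * g')"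
    using * by (simp add: qD_mult algebra_simps)
  ultimately show ?thesis using * lat_mult by (auto simp: lat_deriv_def)
qed

lemma lat_deriv_power: "lat_deriv w f \<Longrightarrow> lat_deriv (w * n) (f ^ n)"
proof (induction n)
  case 0
  have "qD 1 = fps_const 2 * 0" by (simp add: qD_def)
  then show ?case using lat_one by (auto simp: lat_deriv_def intro!: bexI[of _ 0] lat.zero)
next
  case (Suc n)
  then show ?case using lat_deriv_mult[of w f "w * n" "f ^ n"] by simp
qed

text \<open>The heat identity is multiplied by 2^-(n-1). The products carry the same scale as weight
  n, since n - 2 = (k - 1) + (n - k - 1); weight n + 2 would need 2^-n, so a factor 2 is left over
  on the right.\<close>

lemma sG_heat:
  assumes n: "even n" "n \<ge> 2"
  shows "qD (sG n) + (\<Sum>k | odd k \<and> k \<le> n. fps_const (of_nat (n choose k)) * (sG (Suc k) * sG (n + 1 - k))) =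
    fps_const (2 * (of_nat (n + 3) / of_nat (n + 1))) * sG (n + 2)"
proof -
  let ?r = "rat_of_nat (n + 3) / of_nat (n + 1)"
  let ?p = "1 / 2 ^ (n - 1) :: rat"
  have p: "?p * 2 = 1 / 2 ^ (n - 2)" "2 * ?r * (1 / 2 ^ n) = ?p * ?r"
    using n by (auto simp: power_diff field_simps simp del: of_nat_add)
  have distr: "fps_const c * (2 * X + 2 * S) = fps_const (c * 2) * X + fps_const (c * 2) * S"
    for c and X S :: "rat fps"
    by (simp only: fps_const_mult[symmetric] numeral_fps_const distrib_left mult.assoc)
  have "fps_const (2 * ?r) * sG (n + 2) = fps_const (2 * ?r * (1 / 2 ^ n)) * G (n + 2)"
    by (simp only: sG_def diff_add_inverse2 fps_const_mult mult.assoc[symmetric])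
  also have "\<dots> = fps_const ?p * (fps_const ?r * G (n + 2))"
    unfolding p by (simp only: fps_const_mult mult.assoc[symmetric])
  also have "\<dots> = fps_const (?p * 2) * qD (G n) +
      (\<Sum>k | odd k \<and> k \<le> n. fps_const (?p * 2) * (fps_const (of_nat (n choose k)) * (G (Suc k) * G (n + 1 - k))))"
    unfolding heat_identity[OF n] sum_distrib_left[symmetric] fps_of_nat by (rule distr)
  also have "fps_const (?p * 2) * qD (G n) = qD (sG n)"
    unfolding p sG_def qD_scale by simp
  also have "(\<Sum>k | odd k \<and> k \<le> n. fps_const (?p * 2) * (fps_const (of_nat (n choose k)) * (G (Suc k) * G (n + 1 - k)))) =
     (\<Sum>k | odd k \<and> k \<le> n. fps_const (of_nat (n choose k)) * (sG (Suc k) * sG (n + 1 - k)))"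
  proof (intro sum.cong refl)
    fix k assume "k \<in> {k. odd k \<and> k \<le> n}"
    then have k: "odd k" "k < n" using n by (auto simp: le_less)
    then have "n - 2 = (Suc k - 2) + (n + 1 - k - 2)" by (auto elim!: oddE)
    then have "?p * 2 = 1 / 2 ^ (Suc k - 2) * (1 / 2 ^ (n + 1 - k - 2))"
      unfolding p by (simp add: power_add)
    then show "fps_const (?p * 2) * (fps_const (of_nat (n choose k)) * (G (Suc k) * G (n + 1 - k))) =
        fps_const (of_nat (n choose k)) * (sG (Suc k) * sG (n + 1 - k))"
      unfolding sG_def by (simp only: fps_const_mult[symmetric]) (simp add: mult.assoc mult.left_commute)
  qed
  finally show ?thesis by simp
qed

text \<open>In k binom(n,k) = n binom(n-1,k-1) the right side is even and k is odd.\<close>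

lemma even_binomial: "even n \<Longrightarrow> odd k \<Longrightarrow> even (n choose k)"
proof (cases k)
  case (Suc j)
  assume "even n" "odd k"
  have "k * (n choose k) = n * ((n - 1) choose j)"
    using times_binomial_minus1_eq[of k n] Suc by simp
  then show "even (n choose k)" using \<open>even n\<close> \<open>odd k\<close> by (metis even_mult_iff)
qed simp

lemma sG_conv_lat:
  assumes n: "even n" and sG: "\<And>k. even k \<Longrightarrow> 2 \<le> k \<Longrightarrow> k \<le> n \<Longrightarrow> sG k \<in> lat k"
  obtains h where "h \<in> lat (n + 2)"
    "(\<Sum>k | odd k \<and> k \<le> n. fps_const (of_nat (n choose k)) * (sG (Suc k) * sG (n + 1 - k))) = fps_const 2 * h"
proof
  let ?O = "{k. odd k \<and> k \<le> n}"
  show "(\<Sum>k\<in>?O. fps_const (of_nat ((n choose k) div 2)) * (sG (Suc k) * sG (n + 1 - k))) \<in> lat (n + 2)"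
  proof (intro lat_sum lat.scale two_integral_of_nat)
    fix k assume "k \<in> ?O"
    \<comment> \<open>Parity excludes k = n, so both weights k + 1 and n + 1 - k are at most n,
      within reach of the hypothesis.\<close>
    then have "odd k" "k < n" using n by (auto simp: le_less)
    then have "sG (Suc k) * sG (n + 1 - k) \<in> lat (Suc k + (n + 1 - k))"
      using n by (intro lat_mult sG) (auto elim!: oddE evenE)
    then show "sG (Suc k) * sG (n + 1 - k) \<in> lat (n + 2)" using \<open>k < n\<close> by simp
  qed
  show "(\<Sum>k\<in>?O. fps_const (of_nat (n choose k)) * (sG (Suc k) * sG (n + 1 - k))) =
    fps_const 2 * (\<Sum>k\<in>?O. fps_const (of_nat ((n choose k) div 2)) * (sG (Suc k) * sG (n + 1 - k)))"
    unfolding sum_distrib_left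
  proof (intro sum.cong refl)
    fix k assume "k \<in> ?O"
    then have "n choose k = 2 * ((n choose k) div 2)" using even_binomial[OF n, of k] by simp
    then have "rat_of_nat (n choose k) = 2 * of_nat ((n choose k) div 2)"
      by (metis of_nat_mult of_nat_numeral)
    then show "fps_const (of_nat (n choose k)) * (sG (Suc k) * sG (n + 1 - k)) =
      fps_const 2 * (fps_const (of_nat ((n choose k) div 2)) * (sG (Suc k) * sG (n + 1 - k)))"
      by (simp flip: mult.assoc)
  qed
qed

text \<open>The rescaled heat identity is solved for the derivative: the convolution and the term of
  weight n + 2 are both even. For n = 6 this needs weight 8, supplied by
  \<open>G8_eq\<close>.\<close>

lemma lat_deriv_sG:
  assumes n: "even n" "n \<ge> 2" and sG: "\<And>k. even k \<Longrightarrow> 2 \<le> k \<Longrightarrow> k \<le> n + 2 \<Longrightarrow> sG k \<in> lat k"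
  shows "lat_deriv n (sG n)"
proof -
  obtain h where h: "h \<in> lat (n + 2)"
    "(\<Sum>k | odd k \<and> k \<le> n. fps_const (of_nat (n choose k)) * (sG (Suc k) * sG (n + 1 - k))) = fps_const 2 * h"
    by (rule sG_conv_lat[of n]) (use n sG in auto)
  have *: "x + c * h = c * r * s \<Longrightarrow> x = c * (r * s - h)" for x c r s :: "rat fps"
    by (simp add: algebra_simps eq_diff_eq)
  have "qD (sG n) = fps_const 2 * (fps_const (of_nat (n + 3) / of_nat (n + 1)) * sG (n + 2) - h)"
    using sG_heat[OF n] unfolding h fps_const_mult[symmetric] by (rule *)
  moreover have "fps_const (of_nat (n + 3) / of_nat (n + 1)) * sG (n + 2) - h \<in> lat (n + 2)"
    using n by (intro lat_diff h lat.scale sG two_integral_divide_of_nat) auto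
  moreover have "sG n \<in> lat n" by (rule sG) (use n in auto)
  ultimately show ?thesis unfolding lat_deriv_def by blast
qed

lemma sG_lat_small:
  assumes "even k" "2 \<le> k" "k \<le> 8"
  shows "sG k \<in> lat k"
proof -
  have "k = 2 \<or> k = 4 \<or> k = 6 \<or> k = 8" using assms by presburger
  then consider "k = 2" | "k = 4" | "k = 6" | "k = 8" by blast
  then show ?thesis
  proof cases
    case 1 then show ?thesis using lat.emon[of "(1, 0, 0)" 2] by (simp add: emon_def ewt_def)
  next
    case 2 then show ?thesis using lat.emon[of "(0, 1, 0)" 4] by (simp add: emon_def ewt_def)
  next
    case 3 then show ?thesis using lat.emon[of "(0, 0, 1)" 6] by (simp add: emon_def ewt_def)
  next
    case 4
    \<comment> \<open>The scales 2^-6 of weight 8 and 2^-2 of weight 4 turn 120 into 120 * 16 / 64 =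
      30.\<close>
    have "sG 8 = fps_const (of_nat 30) * emon (0, 2, 0)"
    proof -
      have "sG 8 = fps_const (1 / 64) * (fps_const 120 * (G 4 * G 4))"
        by (simp add: sG_def G8_eq numeral_fps_const)
      moreover have "fps_const (of_nat 30) * emon (0, 2, 0) = fps_const 30 * (fps_const (1 / 4) * (fps_const (1 / 4) * (G 4 * G 4)))"
        by (simp add: emon_def sG_def power2_eq_square mult_ac)
      ultimately show ?thesis by (simp flip: mult.assoc)
    qed
    moreover have "fps_const (of_nat 30) * emon (0, 2, 0) \<in> lat 8"
      by (intro lat.scale two_integral_of_nat lat.emon) (simp add: ewt_def)
    ultimately show ?thesis using 4 by simp
  qed
qed

section \<open>Derivatives of lattice elements and the higher Eisenstein series\<close>

lemma lat_deriv_emon: "lat_deriv (ewt m) (emon m)"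
proof -
  have s: "lat_deriv k (sG k)" if "k \<in> {2, 4, 6}" for k
    by (rule lat_deriv_sG) (use that in \<open>auto intro: sG_lat_small\<close>)
  show ?thesis
    using lat_deriv_mult[OF lat_deriv_mult[OF lat_deriv_power[OF s[of 2]] lat_deriv_power[OF s[of 4]]] lat_deriv_power[OF s[of 6]]]
    by (simp add: emon_def ewt_def case_prod_unfold)
qed

lemma lat_imp_lat_deriv: "f \<in> lat w \<Longrightarrow> lat_deriv w f"
proof (induction rule: lat.induct)
  case zero
  then show ?case using lat.zero by (force simp: lat_deriv_def qD_def)
next
  case (emon m)
  then show ?case using lat_deriv_emon by metis
next
  case (add f g)
  then obtain f' g' where *: "f' \<in> lat (w + 2)" "g' \<in> lat (w + 2)"
    "qD f = fps_const 2 * f'" "qD g = fps_const 2 * g'" by (auto simp: lat_deriv_def)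
  then have "qD (f + g) = fps_const 2 * (f' + g')" by (simp add: qD_add distrib_left)
  then show ?case using * add lat.add unfolding lat_deriv_def by blast
next
  case (scale r f)
  then obtain f' where *: "f' \<in> lat (w + 2)" "qD f = fps_const 2 * f'" by (auto simp: lat_deriv_def)
  then have "qD (fps_const r * f) = fps_const 2 * (fps_const r * f')"
    by (simp add: qD_scale mult.left_commute)
  then show ?case using * scale lat.scale unfolding lat_deriv_def by blast
qed

text \<open>Above weight 8 the heat identity is solved for the highest weight. The derivative and
  the convolution are even, so the factor 2 before \<open>sG (n + 2)\<close> cancels, and what
  remains to divide by is a unit of Z_(2).\<close>

lemma sG_lat: "even k \<Longrightarrow> k \<ge> 2 \<Longrightarrow> sG k \<in> lat k"
proof (induction k rule: less_induct)
  case (less k)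
  show ?case
  proof (cases "k \<le> 8")
    case True
    then show ?thesis using less.prems by (rule sG_lat_small[rotated 2])
  next
    case False
    define n where "n = k - 2"
    have n: "even n" "n \<ge> 2" "k = n + 2" using False less.prems by (auto simp: n_def)
    obtain h where h: "h \<in> lat (n + 2)"
      "(\<Sum>k | odd k \<and> k \<le> n. fps_const (of_nat (n choose k)) * (sG (Suc k) * sG (n + 1 - k))) = fps_const 2 * h"
      by (rule sG_conv_lat[of n]) (use n less.IH in auto)
    obtain g where g: "g \<in> lat (n + 2)" "qD (sG n) = fps_const 2 * g"
      using lat_imp_lat_deriv[OF less.IH[of n]] n by (auto simp: lat_deriv_def)
    let ?s = "rat_of_nat (n + 1) / of_nat (n + 3)"
    define r where "r = rat_of_nat (n + 3) / of_nat (n + 1)"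
    have r: "r \<noteq> 0" "1 / r = ?s"
      unfolding r_def by (simp_all only: divide_eq_0_iff of_nat_eq_0_iff) simp_all
    have "fps_const (2 * r) * sG (n + 2) = fps_const 2 * (g + h)"
      using sG_heat[OF n(1,2)] unfolding h g r_def by (simp add: distrib_left)
    then have "fps_const (1 / r / 2) * (fps_const (2 * r) * sG (n + 2)) = fps_const (1 / r / 2) * (fps_const 2 * (g + h))"
      by simp
    then have "sG (n + 2) = fps_const ?s * (g + h)"
      unfolding r(2)[symmetric] using r(1) by (simp flip: mult.assoc)
    moreover have "fps_const ?s * (g + h) \<in> lat (n + 2)"
      using n g h by (intro lat.scale lat.add two_integral_divide_of_nat) auto
    ultimately show ?thesis using n by simp
  qed
qed

lemma finite_ewt: "finite {m. ewt m = w}"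
  by (rule finite_subset[of _ "{..w} \<times> {..w} \<times> {..w}"]) (auto simp: ewt_def)

lemma lat_expand:
  assumes "f \<in> lat w"
  shows "\<exists>x. (\<forall>m. x m \<in> two_integral) \<and> f = (\<Sum>m | ewt m = w. fps_const (x m) * emon m)"
  using assms
proof (induction rule: lat.induct)
  case zero
  then show ?case using two_integral_of_nat[of 0] by (intro exI[of _ "\<lambda>_. 0"]) auto
next
  case (emon m)
  have "(\<Sum>m' | ewt m' = w. fps_const (if m' = m then 1 else 0) * emon m') =
     (\<Sum>m' | ewt m' = w. if m' = m then emon m' else 0)"
    by (intro sum.cong refl) auto
  also have "\<dots> = emon m" using emon finite_ewt by (simp add: sum.delta')
  finally show ?case using two_integral_of_nat[of 0] two_integral_of_nat[of 1]
    by (intro exI[of _ "\<lambda>m'. if m' = m then 1 else 0"]) auto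
next
  case (add f g)
  then obtain x y where "\<forall>m. x m \<in> two_integral" "f = (\<Sum>m | ewt m = w. fps_const (x m) * emon m)"
    "\<forall>m. y m \<in> two_integral" "g = (\<Sum>m | ewt m = w. fps_const (y m) * emon m)" by blast
  then show ?case
    by (intro exI[of _ "\<lambda>m. x m + y m"])
       (auto simp: two_integral_add distrib_right sum.distrib simp flip: fps_const_add)
next
  case (scale r f)
  then obtain x where "\<forall>m. x m \<in> two_integral" "f = (\<Sum>m | ewt m = w. fps_const (x m) * emon m)" by blast
  then show ?case using scale.hyps
    by (intro exI[of _ "\<lambda>m. r * x m"])
       (auto simp: two_integral_mult sum_distrib_left mult.assoc simp flip: fps_const_mult)
qed

section \<open>The recursion for brackets of products\<close>

lemma is_partition_add_replicate:
  "m > 0 \<Longrightarrow> is_partition (la + replicate_mset r m) \<longleftrightarrow> is_partition la"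
  by (auto simp: is_partition_def)

lemma size_part_add_replicate: "size_part (la + replicate_mset r m) = size_part la + m * r"
  by (simp add: size_part_def sum_mset_replicate_mset mult.commute)

lemma finite_partitions_of: "finite (partitions_of n)"
proof (rule finite_subset)
  show "partitions_of n \<subseteq> (\<Union>k\<le>n. mset ` {xs. set xs \<subseteq> {..n} \<and> length xs = k})"
  proof
    fix la assume la: "la \<in> partitions_of n"
    have "size la \<le> sum_mset la" if "is_partition la" for la
      using that by (induction la) (auto simp: is_partition_def)
    then have "size la \<le> n" using la by (auto simp: partitions_of_def size_part_def)
    moreover have "set_mset la \<subseteq> {..n}"
      using la by (auto simp: partitions_of_def size_part_def dest: multi_member_split)
    moreover obtain xs where xs: "mset xs = la" using ex_mset by blast
    ultimately have "length xs \<le> n" "set xs \<subseteq> {..n}" by auto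
    then have "la \<in> mset ` {ys. set ys \<subseteq> {..n} \<and> length ys = length xs}" using xs by blast
    then show "la \<in> (\<Union>k\<le>n. mset ` {xs. set xs \<subseteq> {..n} \<and> length xs = k})"
      using \<open>length xs \<le> n\<close> by blast
  qed
qed (auto intro: finite_lists_length_eq)

definition wsum :: "(partition \<Rightarrow> rat) \<Rightarrow> rat fps" where
  "wsum f = Abs_fps (\<lambda>n. \<Sum>la\<in>partitions_of n. f la)"

lemma wsum_nth: "wsum f $ n = (\<Sum>la\<in>partitions_of n. f la)"
  by (simp add: wsum_def)

lemma qbracket_eq: "qbracket f = wsum f * inverse (wsum (\<lambda>_. 1))"
  by (simp add: qbracket_def wsum_def)

lemma wsum_one_0: "wsum (\<lambda>_. 1) $ 0 = 1"
proof -
  have "partitions_of 0 = {{#}}"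
  proof -
    have "la = {#}" if "is_partition la" "sum_mset la = 0" for la
      using that by (cases la) (auto simp: is_partition_def)
    then show ?thesis by (auto simp: partitions_of_def size_part_def) (auto simp: is_partition_def)
  qed
  then show ?thesis by (simp add: wsum_nth)
qed

lemma qbracket_one: "qbracket (\<lambda>_. 1) = 1"
  unfolding qbracket_eq using wsum_one_0 by (simp add: inverse_mult_eq_1')

lemma wsum_add: "wsum (\<lambda>la. f la + g la) = wsum f + wsum g"
  by (rule fps_ext) (simp add: wsum_nth sum.distrib)

lemma wsum_scale: "wsum (\<lambda>la. c * f la) = fps_const c * wsum f"
  by (rule fps_ext) (simp add: wsum_nth sum_distrib_left)

lemma qbracket_add: "qbracket (\<lambda>la. f la + g la) = qbracket f + qbracket g"
  by (simp add: qbracket_eq wsum_add distrib_right)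

lemma qbracket_scale: "qbracket (\<lambda>la. c * f la) = fps_const c * qbracket f"
  by (simp add: qbracket_eq wsum_scale mult.assoc)

lemma sum_mset_eq_sum_count:
  fixes g :: "'a \<Rightarrow> 'b :: comm_semiring_1"
  assumes "finite X" "set_mset M \<subseteq> X"
  shows "(\<Sum>p\<in>#M. g p) = (\<Sum>m\<in>X. of_nat (count M m) * g m)"
  using assms(2)
proof (induction M)
  case (add x M)
  have "(\<Sum>m\<in>X. of_nat (count (add_mset x M) m) * g m) =
      (\<Sum>m\<in>X. (if m = x then g m else 0) + of_nat (count M m) * g m)"
    by (intro sum.cong refl) (auto simp: distrib_right)
  also have "\<dots> = g x + (\<Sum>m\<in>X. of_nat (count M m) * g m)"
    using add.prems assms(1) by (simp add: sum.distrib)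
  finally show ?case using add by simp
qed simp

text \<open>The r-th copy of a part m becomes the pair (m, r). The bound m * r <= n cuts out a
  finite range of pairs common to all partitions of n, so that the two summations can be
  exchanged.\<close>

lemma sum_mset_as_multiplicities:
  assumes "la \<in> partitions_of n"
  shows "(\<Sum>p\<in>#la. g p) = (\<Sum>(m, r) | 0 < m \<and> 0 < r \<and> m * r \<le> n \<and> r \<le> count la m. g m :: rat)"
proof -
  have la: "is_partition la" "sum_mset la = n"
    using assms by (auto simp: partitions_of_def size_part_def)
  have "(\<Sum>p\<in>#la. g p) = (\<Sum>m\<in>set_mset la. of_nat (count la m) * g m)"
    by (rule sum_mset_eq_sum_count) auto
  also have "\<dots> = (\<Sum>m\<in>set_mset la. \<Sum>r\<in>{0<..count la m}. g m)" by simp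
  also have "\<dots> = (\<Sum>(m, r) \<in> (SIGMA m:set_mset la. {0<..count la m}). g m)"
    by (subst sum.Sigma) auto
  also have "(SIGMA m:set_mset la. {0<..count la m}) =
      {(m, r). 0 < m \<and> 0 < r \<and> m * r \<le> n \<and> r \<le> count la m}"
  proof -
    have "m * r \<le> n" if "r \<le> count la m" for m r
    proof -
      have "replicate_mset r m \<subseteq># la" using that by (simp add: count_le_replicate_mset_subset_eq)
      then have "la = (la - replicate_mset r m) + replicate_mset r m" by simp
      then have "sum_mset la = sum_mset (la - replicate_mset r m) + m * r"
        by (metis size_part_add_replicate size_part_def)
      then show ?thesis using la by simp
    qed
    moreover have "m > 0" if "m \<in># la" for m using la that by (auto simp: is_partition_def)
    ultimately show ?thesis by (auto simp flip: count_greater_zero_iff)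
  qed
  finally show ?thesis .
qed

lemma sum_partitions_with_multiplicity:
  assumes "0 < m" "m * r \<le> n"
  shows "(\<Sum>la | la \<in> partitions_of n \<and> r \<le> count la m. f la :: rat) = wsum (\<lambda>la. f (la + replicate_mset r m)) $ (n - m * r)"
  unfolding wsum_nth
proof (rule sum.reindex_bij_witness[where i = "\<lambda>la. la + replicate_mset r m" and j = "\<lambda>la. la - replicate_mset r m"])
  fix la assume la: "la \<in> {la \<in> partitions_of n. r \<le> count la m}"
  then have "replicate_mset r m \<subseteq># la" by (simp add: count_le_replicate_mset_subset_eq)
  then have *: "la - replicate_mset r m + replicate_mset r m = la" by simp
  then show "la - replicate_mset r m + replicate_mset r m = la"
    "f (la - replicate_mset r m + replicate_mset r m) = f la" by simp_all
  show "la - replicate_mset r m \<in> partitions_of (n - m * r)"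
    using la is_partition_add_replicate[OF assms(1), of "la - replicate_mset r m" r]
      size_part_add_replicate[of "la - replicate_mset r m" r m] unfolding *
    by (auto simp: partitions_of_def)
next
  fix la assume "la \<in> partitions_of (n - m * r)"
  then show "la + replicate_mset r m \<in> {la \<in> partitions_of n. r \<le> count la m}"
    using assms by (auto simp: partitions_of_def is_partition_add_replicate size_part_add_replicate)
qed auto

text \<open>The pairs \<open>(m, r)\<close> count the \<open>r\<close>-th copy of the part \<open>m\<close>; removing \<open>r\<close> copies of \<open>m\<close>
  leaves an arbitrary partition.\<close>

lemma wsum_power_sum_mult:
  "wsum (\<lambda>la. (\<Sum>p\<in>#la. g p) * f la) $ n =
   (\<Sum>(m, r) | 0 < m \<and> 0 < r \<and> m * r \<le> n. g m * wsum (\<lambda>la. f (la + replicate_mset r m)) $ (n - m * r))"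
proof -
  let ?I = "{(m, r). 0 < m \<and> 0 < r \<and> m * r \<le> n}"
  have fin: "finite ?I"
  proof (rule finite_subset)
    show "?I \<subseteq> {..n} \<times> {..n}"
    proof
      fix p assume "p \<in> ?I"
      then obtain m r where "p = (m, r)" "0 < m" "0 < r" "m * r \<le> n" by auto
      moreover from this have "m \<le> m * r" "r \<le> m * r" by auto
      ultimately have "m \<le> n" "r \<le> n" by linarith+
      then show "p \<in> {..n} \<times> {..n}" using \<open>p = (m, r)\<close> by simp
    qed
  qed simp
  have "wsum (\<lambda>la. (\<Sum>p\<in>#la. g p) * f la) $ n =
     (\<Sum>la\<in>partitions_of n. \<Sum>(m, r)\<in>?I. if r \<le> count la m then g m * f la else 0)"
    unfolding wsum_nth
  proof (intro sum.cong refl)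
    fix la assume "la \<in> partitions_of n"
    then have "(\<Sum>p\<in>#la. g p) * f la = (\<Sum>(m, r) | 0 < m \<and> 0 < r \<and> m * r \<le> n \<and> r \<le> count la m. g m) * f la"
      by (simp only: sum_mset_as_multiplicities)
    also have "\<dots> = (\<Sum>(m, r) \<in> {p \<in> ?I. snd p \<le> count la (fst p)}. g m * f la)"
      unfolding sum_distrib_right by (intro sum.cong) auto
    also have "\<dots> = (\<Sum>(m, r)\<in>?I. if r \<le> count la m then g m * f la else 0)"
      by (subst sum.inter_filter[OF fin]) (auto intro!: sum.cong)
    finally show "(\<Sum>p\<in>#la. g p) * f la = (\<Sum>(m, r)\<in>?I. if r \<le> count la m then g m * f la else 0)" .
  qed
  also have "\<dots> = (\<Sum>(m, r)\<in>?I. \<Sum>la\<in>partitions_of n. if r \<le> count la m then g m * f la else 0)"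
    by (subst sum.swap) (simp add: case_prod_unfold)
  also have "\<dots> = (\<Sum>(m, r)\<in>?I. g m * wsum (\<lambda>la. f (la + replicate_mset r m)) $ (n - m * r))"
  proof (intro sum.cong refl, clarify)
    fix m r assume *: "0 < m" "0 < r" "m * r \<le> n"
    have "(\<Sum>la\<in>partitions_of n. if r \<le> count la m then g m * f la else 0) =
       (\<Sum>la | la \<in> partitions_of n \<and> r \<le> count la m. g m * f la)"
      by (rule sum.inter_filter[OF finite_partitions_of, symmetric])
    then show "(\<Sum>la\<in>partitions_of n. if r \<le> count la m then g m * f la else 0) =
       g m * wsum (\<lambda>la. f (la + replicate_mset r m)) $ (n - m * r)"
      using sum_partitions_with_multiplicity[OF *(1,3), of f] by (simp add: sum_distrib_left[symmetric])
  qed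
  finally show ?thesis .
qed

section \<open>Derivatives of divisor-sum series\<close>

lemma qD_power_divsum_fps_nth:
  "((qD ^^ s) (divsum_fps u)) $ n = (if n = 0 then 0 else \<Sum>m | m dvd n. of_nat m ^ (u + s) * of_nat (n div m) ^ s)"
proof -
  have "((qD ^^ s) f) $ n = of_nat n ^ s * f $ n" for f
    by (induction s) (simp_all add: qD_nth)
  moreover have "of_nat n ^ s * divsum u n = (\<Sum>m | m dvd n. of_nat m ^ (u + s) * of_nat (n div m) ^ s)"
    unfolding divsum_def sum_distrib_left
  proof (intro sum.cong refl)
    fix m assume "m \<in> {m. m dvd n}"
    then have "rat_of_nat n = of_nat m * of_nat (n div m)"
      by (metis dvd_mult_div_cancel mem_Collect_eq of_nat_mult)
    then show "rat_of_nat n ^ s * of_nat m ^ u = of_nat m ^ (u + s) * of_nat (n div m) ^ s"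
      by (simp only: power_mult_distrib power_add) (simp add: mult_ac)
  qed
  ultimately show ?thesis by (simp add: divsum_fps_def)
qed

text \<open>As m^(u+s) r^s = m^u (m r)^s, every power of r paired with a power of m amounts to one
  application of \<open>qD\<close>. This is how the recursion acquires its derivatives.\<close>

lemma qD_power_divsum_fps_mult_nth:
  "((qD ^^ s) (divsum_fps u) * F) $ n =
   (\<Sum>(m, r) | 0 < m \<and> 0 < r \<and> m * r \<le> n. of_nat m ^ (u + s) * of_nat r ^ s * F $ (n - m * r))"
proof -
  let ?t = "\<lambda>m r. of_nat m ^ (u + s) * of_nat r ^ s :: rat"
  have "((qD ^^ s) (divsum_fps u) * F) $ n = (\<Sum>i\<in>{0..n}. ((qD ^^ s) (divsum_fps u)) $ i * F $ (n - i))"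
    by (simp add: fps_mult_nth)
  also have "\<dots> = (\<Sum>i\<in>{0<..n}. ((qD ^^ s) (divsum_fps u)) $ i * F $ (n - i))"
    by (rule sum.mono_neutral_right) (auto simp: qD_power_divsum_fps_nth)
  also have "\<dots> = (\<Sum>i\<in>{0<..n}. \<Sum>m | m dvd i. ?t m (i div m) * F $ (n - i))"
    by (intro sum.cong refl) (auto simp: qD_power_divsum_fps_nth sum_distrib_right)
  also have "\<dots> = (\<Sum>(i, m)\<in>(SIGMA i:{0<..n}. {m. m dvd i}). ?t m (i div m) * F $ (n - i))"
    by (subst sum.Sigma) auto
  also have "\<dots> = (\<Sum>(m, r) | 0 < m \<and> 0 < r \<and> m * r \<le> n. ?t m r * F $ (n - m * r))"
    by (rule sum.reindex_bij_witness[where j = "\<lambda>(i, m). (m, i div m)" and i = "\<lambda>(m, r). (m * r, m)"])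
       (auto intro: Nat.gr0I)
  finally show ?thesis by simp
qed

lemma S_fun_add_replicate:
  "S_fun k (la + replicate_mset r m) = S_fun k la + of_nat r * of_nat m ^ (k - 1)"
  by (simp add: S_fun_def)

text \<open>The indexed family permits repeated generators and still lets subsets of the factors be
  selected.\<close>

definition S_prod :: "('i \<Rightarrow> nat) \<Rightarrow> 'i set \<Rightarrow> partition \<Rightarrow> rat" where
  "S_prod K J = (\<lambda>la. \<Prod>j\<in>J. S_fun (K j) la)"

text \<open>\<open>A\<close> collects the factors that contribute the new term r m^(k_j - 1).
  Writing k_j - 1 = (k_j - 2) + 1 pairs each r with one m, in preparation for the
  derivatives.\<close>

lemma S_prod_add_replicate:
  assumes "finite J" "\<And>j. j \<in> J \<Longrightarrow> K j \<ge> 2"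
  shows "S_prod K J (la + replicate_mset r m) =
    (\<Sum>A\<in>Pow J. of_nat r ^ card A * of_nat m ^ ((\<Sum>j\<in>A. K j - 2) + card A) * S_prod K (J - A) la)"
proof -
  have "S_prod K J (la + replicate_mset r m) = (\<Prod>j\<in>J. of_nat r * of_nat m ^ (K j - 1) + S_fun (K j) la)"
    by (simp add: S_prod_def S_fun_add_replicate add.commute)
  also have "\<dots> = (\<Sum>A\<in>Pow J. (\<Prod>j\<in>A. of_nat r * of_nat m ^ (K j - 1)) * S_prod K (J - A) la)"
    unfolding S_prod_def by (rule prod_add[OF assms(1)])
  also have "\<dots> = (\<Sum>A\<in>Pow J. of_nat r ^ card A * of_nat m ^ ((\<Sum>j\<in>A. K j - 2) + card A) * S_prod K (J - A) la)"
  proof (intro sum.cong refl)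
    fix A assume A: "A \<in> Pow J"
    have "(\<Sum>j\<in>A. K j - 1) = (\<Sum>j\<in>A. (K j - 2) + 1)"
      using A assms(2) by (intro sum.cong refl) force
    then have "(\<Sum>j\<in>A. K j - 1) = (\<Sum>j\<in>A. K j - 2) + card A" by (simp only: sum.distrib) simp
    then show "(\<Prod>j\<in>A. of_nat r * of_nat m ^ (K j - 1)) * S_prod K (J - A) la =
      of_nat r ^ card A * of_nat m ^ ((\<Sum>j\<in>A. K j - 2) + card A) * S_prod K (J - A) la"
      unfolding prod.distrib power_sum[symmetric] by simp
  qed
  finally show ?thesis .
qed

lemma wsum_sum: "wsum (\<lambda>la. \<Sum>i\<in>I. f i la) = (\<Sum>i\<in>I. wsum (f i))"
  by (rule fps_ext) (simp add: wsum_nth fps_sum_nth sum.swap[of _ I])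

lemma qD_power_G_Suc: "(qD ^^ Suc s) (G k) = (qD ^^ Suc s) (divsum_fps (k - 1))"
  by (simp add: G_eq qD_add qD_const del: funpow.simps add: funpow_Suc_right)

text \<open>The power sum in \<open>S_fun k\<close> yields the divisor-sum series. Its constant
  completes the term \<open>A = {}\<close> to \<open>G k\<close>; in all other terms a derivative
  removes the constant of the Eisenstein series.\<close>

lemma wsum_S_fun_mult:
  assumes "finite J" "\<And>j. j \<in> J \<Longrightarrow> K j \<ge> 2" "k \<ge> 2"
  shows "wsum (\<lambda>la. S_fun k la * S_prod K J la) =
    (\<Sum>A\<in>Pow J. (qD ^^ card A) (G (k + (\<Sum>j\<in>A. K j - 2))) * wsum (S_prod K (J - A)))"
proof -
  let ?k = "\<lambda>A. k + (\<Sum>j\<in>A. K j - 2)"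
  have main: "wsum (\<lambda>la. (\<Sum>p\<in>#la. of_nat p ^ (k - 1)) * S_prod K J la) =
     (\<Sum>A\<in>Pow J. (qD ^^ card A) (divsum_fps (?k A - 1)) * wsum (S_prod K (J - A)))"
  proof (rule fps_ext)
    fix n :: nat
    let ?I = "{(m, r). 0 < m \<and> 0 < r \<and> m * r \<le> n}"
    have "wsum (\<lambda>la. (\<Sum>p\<in>#la. of_nat p ^ (k - 1)) * S_prod K J la) $ n =
      (\<Sum>(m, r)\<in>?I. of_nat m ^ (k - 1) * wsum (\<lambda>la. S_prod K J (la + replicate_mset r m)) $ (n - m * r))"
      by (rule wsum_power_sum_mult)
    also have "\<dots> = (\<Sum>(m, r)\<in>?I. \<Sum>A\<in>Pow J.
       of_nat m ^ (?k A - 1 + card A) * of_nat r ^ card A * wsum (S_prod K (J - A)) $ (n - m * r))"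
    proof (intro sum.cong refl, clarify)
      fix m r
      have "?k A - 1 + card A = (k - 1) + ((\<Sum>j\<in>A. K j - 2) + card A)" for A
        using assms(3) by simp
      moreover have "S_prod K J (la + replicate_mset r m) =
          (\<Sum>A\<in>Pow J. of_nat r ^ card A * of_nat m ^ ((\<Sum>j\<in>A. K j - 2) + card A) * S_prod K (J - A) la)" for la
        by (rule S_prod_add_replicate) (use assms in auto)
      then have "wsum (\<lambda>la. S_prod K J (la + replicate_mset r m)) =
          (\<Sum>A\<in>Pow J. fps_const (of_nat r ^ card A * of_nat m ^ ((\<Sum>j\<in>A. K j - 2) + card A)) * wsum (S_prod K (J - A)))"
        by (simp only: wsum_sum wsum_scale)
      ultimately show "of_nat m ^ (k - 1) * wsum (\<lambda>la. S_prod K J (la + replicate_mset r m)) $ (n - m * r) =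
        (\<Sum>A\<in>Pow J. of_nat m ^ (?k A - 1 + card A) * of_nat r ^ card A * wsum (S_prod K (J - A)) $ (n - m * r))"
        by (simp add: fps_sum_nth sum_distrib_left power_add mult_ac)
    qed
    also have "\<dots> = (\<Sum>A\<in>Pow J. \<Sum>(m, r)\<in>?I.
       of_nat m ^ (?k A - 1 + card A) * of_nat r ^ card A * wsum (S_prod K (J - A)) $ (n - m * r))"
      unfolding case_prod_unfold by (rule sum.swap)
    finally show "wsum (\<lambda>la. (\<Sum>p\<in>#la. of_nat p ^ (k - 1)) * S_prod K J la) $ n =
     (\<Sum>A\<in>Pow J. (qD ^^ card A) (divsum_fps (?k A - 1)) * wsum (S_prod K (J - A))) $ n"
      unfolding fps_sum_nth qD_power_divsum_fps_mult_nth .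
  qed
  have split: "Pow J = insert {} (Pow J - {{}})" by auto
  have "(\<Sum>A\<in>Pow J. (qD ^^ card A) (G (?k A)) * wsum (S_prod K (J - A))) =
     G k * wsum (S_prod K J) + (\<Sum>A\<in>Pow J - {{}}. (qD ^^ card A) (G (?k A)) * wsum (S_prod K (J - A)))"
    by (subst split, subst sum.insert) (use assms in auto)
  also have "(\<Sum>A\<in>Pow J - {{}}. (qD ^^ card A) (G (?k A)) * wsum (S_prod K (J - A))) =
     (\<Sum>A\<in>Pow J - {{}}. (qD ^^ card A) (divsum_fps (?k A - 1)) * wsum (S_prod K (J - A)))"
  proof (intro sum.cong refl)
    fix A assume "A \<in> Pow J - {{}}"
    then have "card A \<noteq> 0" using assms(1) by (auto simp: finite_subset)
    then obtain s where "card A = Suc s" by (cases "card A") auto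
    then show "(qD ^^ card A) (G (?k A)) * wsum (S_prod K (J - A)) =
      (qD ^^ card A) (divsum_fps (?k A - 1)) * wsum (S_prod K (J - A))"
      using qD_power_G_Suc by metis
  qed
  also have "G k * wsum (S_prod K J) + \<dots> = fps_const (eis_const k) * wsum (S_prod K J) +
     (\<Sum>A\<in>Pow J. (qD ^^ card A) (divsum_fps (?k A - 1)) * wsum (S_prod K (J - A)))"
    by (subst (2) split, subst sum.insert) (use assms in \<open>auto simp: G_eq distrib_right\<close>)
  also have "\<dots> = wsum (\<lambda>la. eis_const k * S_prod K J la + (\<Sum>p\<in>#la. of_nat p ^ (k - 1)) * S_prod K J la)"
    unfolding main[symmetric] wsum_add wsum_scale ..
  also have "\<dots> = wsum (\<lambda>la. S_fun k la * S_prod K J la)"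
    by (simp only: S_fun_def eis_const_def distrib_right)
  finally show ?thesis by simp
qed

lemma qbracket_S_fun_mult:
  assumes "finite J" "\<And>j. j \<in> J \<Longrightarrow> K j \<ge> 2" "k \<ge> 2"
  shows "qbracket (\<lambda>la. S_fun k la * S_prod K J la) =
    (\<Sum>A\<in>Pow J. (qD ^^ card A) (G (k + (\<Sum>j\<in>A. K j - 2))) * qbracket (S_prod K (J - A)))"
  unfolding qbracket_eq using wsum_S_fun_mult[of J K k, OF assms] by (simp add: sum_distrib_right mult.assoc)

section \<open>Surjectivity of the bracket\<close>

lemma qD_power_scale: "(qD ^^ s) (fps_const c * f) = fps_const c * (qD ^^ s) f"
  by (induction s) (simp_all add: qD_scale)

lemma qD_power_lat: "f \<in> lat w \<Longrightarrow> (qD ^^ s) f \<in> lat (w + 2 * s)"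
proof (induction s)
  case (Suc s)
  then obtain g where "g \<in> lat (w + 2 * s + 2)" "qD ((qD ^^ s) f) = fps_const (of_nat 2) * g"
    using lat_imp_lat_deriv[of "(qD ^^ s) f"] by (auto simp: lat_deriv_def)
  then show ?case using lat.scale[OF two_integral_of_nat, of g "w + 2 * Suc s" 2] by simp
qed simp

lemma qD_power_lat_even:
  assumes "f \<in> lat w" "s > 0"
  obtains g where "g \<in> lat (w + 2 * s)" "(qD ^^ s) f = fps_const 2 * g"
proof -
  obtain t where t: "s = Suc t" using assms by (cases s) auto
  obtain g where "g \<in> lat (w + 2 * t + 2)" "qD ((qD ^^ t) f) = fps_const 2 * g"
    using lat_imp_lat_deriv[OF qD_power_lat[OF assms(1), of t]] by (auto simp: lat_deriv_def)
  then show ?thesis using that[of g] t by simp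
qed

lemma lat_prod: "(\<And>j. j \<in> J \<Longrightarrow> f j \<in> lat (K j)) \<Longrightarrow> finite J \<Longrightarrow> (\<Prod>j\<in>J. f j) \<in> lat (\<Sum>j\<in>J. K j)"
  by (induction J rule: infinite_finite_induct) (auto intro: lat_one lat_mult)

text \<open>Only the term with \<open>A = {}\<close> of the recursion contains no derivative, so modulo 2 the
  (scaled) bracket is multiplicative on the generators.\<close>

lemma qbracket_S_prod_mod_2:
  assumes "finite J" "\<And>j. j \<in> J \<Longrightarrow> even (K j) \<and> K j \<ge> 2"
  shows "\<exists>h\<in>lat (\<Sum>j\<in>J. K j). fps_const (\<Prod>j\<in>J. 1 / 2 ^ (K j - 2)) * qbracket (S_prod K J) =
    (\<Prod>j\<in>J. sG (K j)) + fps_const 2 * h"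
  using assms
proof (induction J rule: finite_psubset_induct)
  case (psubset J')
  show ?case
  proof (cases "J' = {}")
    case True
    then show ?thesis by (auto intro!: bexI[of _ 0] lat.zero simp: S_prod_def qbracket_one)
  next
    case False
    then obtain p J where J: "J' = insert p J" "p \<notin> J" by (metis Set.set_insert ex_in_conv)
    have fin: "finite J" using psubset J by simp
    let ?s = "\<lambda>j. 1 / 2 ^ (K j - 2) :: rat"
    let ?k = "\<lambda>A. K p + (\<Sum>j\<in>A. K j - 2)"
    let ?b = "\<lambda>A. fps_const (\<Prod>j\<in>J - A. ?s j) * qbracket (S_prod K (J - A))"
    have K: "even (K j)" "K j \<ge> 2" if "j \<in> J'" for j using psubset.prems that by auto
    \<comment> \<open>As p has been removed, \<open>J - A\<close> is a proper subset of
      \<open>J'\<close> even for \<open>A = {}\<close>.\<close>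
    have IH: "\<exists>h\<in>lat (\<Sum>j\<in>J - A. K j). ?b A = (\<Prod>j\<in>J - A. sG (K j)) + fps_const 2 * h" for A
      by (rule psubset.IH) (use J psubset.prems in auto)
    have b_lat: "?b A \<in> lat (\<Sum>j\<in>J - A. K j)" for A
    proof -
      have "(\<Prod>j\<in>J - A. sG (K j)) \<in> lat (\<Sum>j\<in>J - A. K j)"
        by (rule lat_prod) (use fin K J in \<open>auto intro: sG_lat\<close>)
      moreover have "fps_const 2 * h \<in> lat w" if "h \<in> lat w" for h w
        using lat.scale[OF two_integral_of_nat[of 2] that] by simp
      ultimately show ?thesis using IH[of A] lat.add by metis
    qed
    have summand: "fps_const (\<Prod>j\<in>J'. ?s j) * ((qD ^^ card A) (G (?k A)) * qbracket (S_prod K (J - A))) =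
      (qD ^^ card A) (sG (?k A)) * ?b A" if A: "A \<in> Pow J" for A
    proof -
      have "(\<Prod>j\<in>J'. ?s j) = ?s p * (\<Prod>j\<in>A. ?s j) * (\<Prod>j\<in>J - A. ?s j)"
        using J fin A by (simp add: prod.subset_diff[of A J] mult_ac)
      \<comment> \<open>The exponents k - 2 add up to the exponent belonging to the Eisenstein
        series in the recursion, so one scale serves both.\<close>
      also have "?s p * (\<Prod>j\<in>A. ?s j) = 1 / 2 ^ (?k A - 2)"
        using K[of p] J by (simp add: prod_dividef power_add[symmetric] power_sum[symmetric])
      finally show ?thesis
        unfolding sG_def qD_power_scale by (simp only: fps_const_mult[symmetric] mult_ac)
    qed
    have eq: "fps_const (\<Prod>j\<in>J'. ?s j) * qbracket (S_prod K J') = (\<Sum>A\<in>Pow J. (qD ^^ card A) (sG (?k A)) * ?b A)"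
    proof -
      have "S_prod K J' = (\<lambda>la. S_fun (K p) la * S_prod K J la)"
        using J fin by (simp add: S_prod_def)
      then have "qbracket (S_prod K J') = (\<Sum>A\<in>Pow J. (qD ^^ card A) (G (?k A)) * qbracket (S_prod K (J - A)))"
        using qbracket_S_fun_mult[of J K "K p"] fin K J by simp
      then show ?thesis by (simp only: sum_distrib_left) (intro sum.cong refl summand)
    qed
    have k: "even (?k A)" "?k A \<ge> 2" if "A \<in> Pow J" for A
      using K J that by (auto intro!: dvd_add dvd_sum intro: trans_le_add1)
    have "\<exists>h\<in>lat (\<Sum>j\<in>J'. K j). (qD ^^ card A) (sG (?k A)) * ?b A = fps_const 2 * h"
      if A: "A \<in> Pow J - {{}}" for A
    proof -
      have "card A > 0" using A fin by (auto simp: card_gt_0_iff finite_subset)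
      then obtain g where g: "g \<in> lat (?k A + 2 * card A)" "(qD ^^ card A) (sG (?k A)) = fps_const 2 * g"
        using qD_power_lat_even[OF sG_lat[OF k[of A]]] A by blast
      \<comment> \<open>Every element of \<open>A\<close> loses 2 in the Eisenstein weight and
        regains it through one derivative; hence all terms have the same total weight.\<close>
      have "(\<Sum>j\<in>A. K j) = (\<Sum>j\<in>A. (K j - 2) + 2)"
        using A J K by (intro sum.cong refl) force
      then have "(\<Sum>j\<in>A. K j) = (\<Sum>j\<in>A. K j - 2) + 2 * card A" by (simp only: sum.distrib) simp
      then have "(\<Sum>j\<in>J'. K j) = ?k A + 2 * card A + (\<Sum>j\<in>J - A. K j)"
        using J fin A by (simp add: sum.subset_diff[of A J])
      then have "g * ?b A \<in> lat (\<Sum>j\<in>J'. K j)" using lat_mult[OF g(1) b_lat[of A]] by simp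
      then show ?thesis using g by (intro bexI[of _ "g * ?b A"]) (auto simp: mult.assoc)
    qed
    then obtain H where H: "H A \<in> lat (\<Sum>j\<in>J'. K j)" "(qD ^^ card A) (sG (?k A)) * ?b A = fps_const 2 * H A"
      if "A \<in> Pow J - {{}}" for A by metis
    obtain h where h: "h \<in> lat (\<Sum>j\<in>J. K j)" "?b {} = (\<Prod>j\<in>J. sG (K j)) + fps_const 2 * h"
      using IH[of "{}"] by auto
    have split: "Pow J = insert {} (Pow J - {{}})" by auto
    have "(\<Sum>A\<in>Pow J. (qD ^^ card A) (sG (?k A)) * ?b A) = sG (K p) * ?b {} + (\<Sum>A\<in>Pow J - {{}}. fps_const 2 * H A)"
      by (subst split, subst sum.insert) (use fin H(2) in auto)
    also have "\<dots> = (\<Prod>j\<in>J'. sG (K j)) + fps_const 2 * (sG (K p) * h + (\<Sum>A\<in>Pow J - {{}}. H A))"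
      unfolding h sum_distrib_left[symmetric] using J fin by (simp add: algebra_simps)
    finally have "fps_const (\<Prod>j\<in>J'. ?s j) * qbracket (S_prod K J') = \<dots>" unfolding eq .
    moreover have "sG (K p) * h + (\<Sum>A\<in>Pow J - {{}}. H A) \<in> lat (\<Sum>j\<in>J'. K j)"
      using lat_mult[OF sG_lat[of "K p"] h(1)] K[of p] J fin H(1) by (intro lat.add lat_sum) auto
    ultimately show ?thesis by blast
  qed
qed

text \<open>Lists can be extended by one generator at a time, as the induction over
  \<open>S_alg\<close> requires; their positions serve as indices for \<open>S_prod\<close>.\<close>

definition S_mono :: "nat list \<Rightarrow> partition \<Rightarrow> rat" where
  "S_mono ks la = (\<Prod>k\<leftarrow>ks. S_fun k la)"

lemma qbracket_S_mono_mod_2: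
  assumes "\<And>k. k \<in> set ks \<Longrightarrow> even k \<and> k \<ge> 2"
  obtains h where "h \<in> lat (sum_list ks)"
    "fps_const (\<Prod>k\<leftarrow>ks. 1 / 2 ^ (k - 2)) * qbracket (S_mono ks) = (\<Prod>k\<leftarrow>ks. sG k) + fps_const 2 * h"
proof -
  have "S_mono ks = S_prod (\<lambda>i. ks ! i) {0..<length ks}"
    by (simp add: fun_eq_iff S_mono_def S_prod_def prod.list_conv_set_nth)
  then show ?thesis
    using qbracket_S_prod_mod_2[of "{0..<length ks}" "\<lambda>i. ks ! i"] assms that
    by (auto simp: prod.list_conv_set_nth sum.list_conv_set_nth)
qed

lemma S_alg_scale: "f \<in> S_alg \<Longrightarrow> (\<lambda>la. c * f la) \<in> S_alg"
  by (rule S_alg.mult[OF S_alg.const])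

lemma S_mono_in_S_alg: "(\<And>k. k \<in> set ks \<Longrightarrow> even k \<and> k \<ge> 2) \<Longrightarrow> S_mono ks \<in> S_alg"
proof (induction ks)
  case Nil
  then show ?case using S_alg.const[of 1] by (simp add: S_mono_def[abs_def])
next
  case (Cons k ks)
  then show ?case
    using S_alg.mult[OF S_alg.gen[of k], of "S_mono ks"] by (simp add: S_mono_def[abs_def])
qed

lemma qbracket_S_alg_add: "f \<in> qbracket ` S_alg \<Longrightarrow> g \<in> qbracket ` S_alg \<Longrightarrow> f + g \<in> qbracket ` S_alg"
  by (auto simp flip: qbracket_add intro!: S_alg.add)

lemma qbracket_S_alg_scale: "f \<in> qbracket ` S_alg \<Longrightarrow> fps_const c * f \<in> qbracket ` S_alg"
  by (auto simp flip: qbracket_scale intro!: S_alg_scale)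

text \<open>All monomials of one weight are treated at once: each gives one row of a linear system
  modulo the image. That the image is a rational subspace is all that
  \<open>odd_system_solvable\<close> asks of it.\<close>

lemma emon_in_image: "emon m \<in> qbracket ` S_alg"
proof -
  let ?V = "qbracket ` S_alg" and ?I = "{m'. ewt m' = ewt m}"
  have "\<exists>x. (\<forall>m'. x m' \<in> two_integral) \<and>
      emon i + (\<Sum>j\<in>?I. fps_const (2 * x j) * emon j) \<in> ?V" if i: "i \<in> ?I" for i
  proof -
    obtain a b c where abc: "i = (a, b, c)" by (cases i)
    \<comment> \<open>The bracket of this monomial in S_2, S_4, S_6, rescaled, is congruent to
      \<open>emon i\<close> modulo 2.\<close>
    define ks :: "nat list" where "ks = replicate a 2 @ replicate b 4 @ replicate c 6"
    have ks: "even k \<and> k \<ge> 2" if "k \<in> set ks" for k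
      using that by (auto simp: ks_def)
    obtain h where h: "h \<in> lat (sum_list ks)"
      "fps_const (\<Prod>k\<leftarrow>ks. 1 / 2 ^ (k - 2)) * qbracket (S_mono ks) = (\<Prod>k\<leftarrow>ks. sG k) + fps_const 2 * h"
      by (rule qbracket_S_mono_mod_2[of ks]) (use ks in auto)
    have "sum_list ks = ewt m" "(\<Prod>k\<leftarrow>ks. sG k) = emon i"
      using i by (auto simp: ks_def abc ewt_def emon_def sum_list_replicate mult_ac)
    moreover obtain x where x: "\<forall>m'. x m' \<in> two_integral" "h = (\<Sum>j | ewt j = sum_list ks. fps_const (x j) * emon j)"
      using lat_expand[OF h(1)] by blast
    moreover have "fps_const (\<Prod>k\<leftarrow>ks. 1 / 2 ^ (k - 2)) * qbracket (S_mono ks) \<in> ?V"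
      by (intro qbracket_S_alg_scale imageI S_mono_in_S_alg ks)
    ultimately show ?thesis unfolding h(2)
      by (intro exI[of _ x]) (auto simp: sum_distrib_left mult.assoc simp flip: fps_const_mult)
  qed
  then have "\<forall>i\<in>?I. \<exists>x. (\<forall>m'. x m' \<in> two_integral) \<and>
      emon i + (\<Sum>j\<in>?I. fps_const (2 * x j) * emon j) \<in> ?V" by (rule ballI)
  then obtain x where x: "\<forall>i\<in>?I. (\<forall>m'. x i m' \<in> two_integral) \<and>
      emon i + (\<Sum>j\<in>?I. fps_const (2 * x i j) * emon j) \<in> ?V" by (rule bchoice[THEN exE])
  show ?thesis
  proof (rule odd_system_solvable[where V = ?V and I = ?I and c = x])
    show "f + g \<in> ?V" if "f \<in> ?V" "g \<in> ?V" for f g using that by (rule qbracket_S_alg_add)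
    show "fps_const r * f \<in> ?V" if "f \<in> ?V" for r f using that by (rule qbracket_S_alg_scale)
    show "x i j \<in> two_integral" if "i \<in> ?I" for i j using bspec[OF x that] by blast
    show "emon i + (\<Sum>j\<in>?I. fps_const (2 * x i j) * emon j) \<in> ?V" if "i \<in> ?I" for i
      using bspec[OF x that] by blast
  qed (simp_all add: finite_ewt)
qed

section \<open>Quasimodular forms as linear combinations of monomials\<close>

inductive_set emon_span :: "rat fps set" where
  emon: "emon m \<in> emon_span"
| add: "f \<in> emon_span \<Longrightarrow> g \<in> emon_span \<Longrightarrow> f + g \<in> emon_span"
| scale: "f \<in> emon_span \<Longrightarrow> fps_const r * f \<in> emon_span"

lemma emon_span_mult_sG:
  assumes "k \<in> {2, 4, 6}" "f \<in> emon_span"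
  shows "sG k * f \<in> emon_span"
  using assms(2)
proof (induction rule: emon_span.induct)
  case (emon m)
  obtain a b c where m: "m = (a, b, c)" by (cases m)
  have "\<exists>m'. sG k * emon m = emon m'"
    using assms(1)
  proof (elim insertE emptyE)
    assume "k = 2"
    then show ?thesis by (intro exI[of _ "(Suc a, b, c)"]) (simp add: m emon_def mult_ac)
  next
    assume "k = 4"
    then show ?thesis by (intro exI[of _ "(a, Suc b, c)"]) (simp add: m emon_def mult_ac)
  next
    assume "k = 6"
    then show ?thesis by (intro exI[of _ "(a, b, Suc c)"]) (simp add: m emon_def mult_ac)
  qed
  then show ?case using emon_span.emon by metis
next
  case (add f g)
  then show ?case unfolding distrib_left by (intro emon_span.add)
next
  case (scale f r)
  then show ?case unfolding mult.left_commute[of "sG k"] by (intro emon_span.scale)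
qed

lemma G_eq_sG: "G k = fps_const (2 ^ (k - 2)) * sG k"
  by (simp add: sG_def flip: mult.assoc)

text \<open>The image of the bracket is at this stage known only to be a vector space, so the
  algebra must be reduced to a linear span of monomials.\<close>

lemma QMF_subset_emon_span: "QMF \<subseteq> emon_span"
proof
  fix f assume f: "f \<in> QMF"
  \<comment> \<open>The claim is strengthened to stability of the span under multiplication by f, so
    that the product case is a composition; g = 1 recovers the goal.\<close>
  have "f * g \<in> emon_span" if "g \<in> emon_span" for g
    using f that unfolding QMF_def
  proof (induction arbitrary: g rule: fps_alg_gen.induct)
    case (const c)
    then show ?case by (rule emon_span.scale)
  next
    case (gen h)
    then obtain k where k: "k \<in> {2, 4, 6}" "h = G k" by blast
    show ?case unfolding k G_eq_sG mult.assoc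
      by (intro emon_span.scale emon_span_mult_sG k gen)
  next
    case (add f h)
    then show ?case unfolding distrib_right by (intro emon_span.add) blast+
  next
    case (mult f h)
    then show ?case unfolding mult.assoc by blast
  qed
  from this[OF emon_span.emon[of "(0, 0, 0)"]] show "f \<in> emon_span" by (simp add: emon_def)
qed

lemma emon_span_subset_image: "emon_span \<subseteq> qbracket ` S_alg"
proof
  fix f assume "f \<in> emon_span"
  then show "f \<in> qbracket ` S_alg"
    by induction (auto intro: emon_in_image qbracket_S_alg_add qbracket_S_alg_scale)
qed

lemma sG_in_QMF: "k \<in> {2, 4, 6} \<Longrightarrow> sG k \<in> QMF"
  unfolding QMF_def sG_def by (intro fps_alg_gen.mult fps_alg_gen.const fps_alg_gen.gen) auto

lemma QMF_power: "f \<in> QMF \<Longrightarrow> f ^ n \<in> QMF"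
  unfolding QMF_def by (induction n) (auto intro: fps_alg_gen.mult fps_alg_gen.const[of 1, simplified])

lemma lat_subset_QMF: "lat w \<subseteq> QMF"
proof
  fix f assume "f \<in> lat w"
  then show "f \<in> QMF"
  proof induction
    case zero
    then show ?case using fps_alg_gen.const[of 0] by (simp add: QMF_def)
  next
    case (emon m)
    have "sG 2 ^ a * sG 4 ^ b * sG 6 ^ c \<in> QMF" for a b c
      using QMF_power[OF sG_in_QMF] unfolding QMF_def by (intro fps_alg_gen.mult) auto
    then show ?case by (simp add: emon_def case_prod_unfold)
  next
    case (add f g)
    then show ?case unfolding QMF_def by (intro fps_alg_gen.add)
  next
    case (scale r f)
    then show ?case unfolding QMF_def by (intro fps_alg_gen.mult fps_alg_gen.const)
  qed
qed

lemma qbracket_S_mono_in_QMF: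
  assumes "\<And>k. k \<in> set ks \<Longrightarrow> even k \<and> k \<ge> 2"
  shows "qbracket (S_mono ks) \<in> QMF"
proof -
  let ?c = "(\<Prod>k\<leftarrow>ks. 1 / 2 ^ (k - 2)) :: rat"
  obtain h where h: "h \<in> lat (sum_list ks)"
    "fps_const ?c * qbracket (S_mono ks) = (\<Prod>k\<leftarrow>ks. sG k) + fps_const 2 * h"
    by (rule qbracket_S_mono_mod_2[of ks]) (use assms in auto)
  have "(\<Prod>k\<leftarrow>ks. sG k) \<in> lat (sum_list ks)"
    using assms by (induction ks) (auto intro: lat_one lat_mult sG_lat)
  then have "fps_const ?c * qbracket (S_mono ks) \<in> lat (sum_list ks)"
    unfolding h(2) using lat.scale[OF two_integral_of_nat[of 2] h(1)] by (intro lat.add) simp_all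
  then have "fps_const ?c * qbracket (S_mono ks) \<in> QMF"
    using lat_subset_QMF by blast
  then have "fps_const (1 / ?c) * (fps_const ?c * qbracket (S_mono ks)) \<in> QMF"
    unfolding QMF_def by (rule fps_alg_gen.mult[OF fps_alg_gen.const])
  moreover have "?c \<noteq> 0" by (induction ks) auto
  ultimately show ?thesis by (simp flip: mult.assoc)
qed

lemma qbracket_S_alg_in_QMF:
  assumes f: "f \<in> S_alg"
  shows "qbracket f \<in> QMF"
proof -
  let ?valid = "\<lambda>ks. \<forall>k\<in>set ks. even k \<and> k \<ge> 2"
  \<comment> \<open>Membership of the bracket in \<open>QMF\<close> does not pass to products
    directly. Instead, multiplication by any element of \<open>S_alg\<close> is shown to preserve
    \<open>H\<close>; a generator is absorbed into the list, and the constant 1 lies in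
    \<open>H\<close>.\<close>
  define H where "H = {h. \<forall>ks. ?valid ks \<longrightarrow> qbracket (\<lambda>la. h la * S_mono ks la) \<in> QMF}"
  have "(\<lambda>la. f la * h la) \<in> H" if "f \<in> S_alg" "h \<in> H" for f h
    using that
  proof (induction arbitrary: h rule: S_alg.induct)
    case (const c)
    then show ?case unfolding H_def QMF_def
      by (auto simp: mult.assoc qbracket_scale intro: fps_alg_gen.mult fps_alg_gen.const)
  next
    case (gen k)
    have "qbracket (\<lambda>la. S_fun k la * h la * S_mono ks la) \<in> QMF" if "?valid ks" for ks
    proof -
      have "qbracket (\<lambda>la. h la * S_mono (k # ks) la) \<in> QMF"
        using gen that unfolding H_def by auto
      then show ?thesis by (simp add: S_mono_def mult_ac)
    qed
    then show ?case unfolding H_def by blast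
  next
    case (add f g)
    then show ?case unfolding H_def QMF_def
      by (auto simp: distrib_right qbracket_add intro: fps_alg_gen.add)
  next
    case (mult f g)
    then show ?case by (simp add: mult.assoc)
  qed
  moreover have "(\<lambda>_. 1) \<in> H"
    unfolding H_def using qbracket_S_mono_in_QMF by simp
  ultimately have "(\<lambda>la. f la * 1) \<in> H" using f by blast
  then have "?valid ks \<longrightarrow> qbracket (\<lambda>la. f la * 1 * S_mono ks la) \<in> QMF" for ks
    unfolding H_def mem_Collect_eq by (rule spec)
  from this[of "[]"] show ?thesis by (simp add: S_mono_def)
qed

theorem theorem3p4p1:
  shows "qbracket ` S_alg = QMF"
  using qbracket_S_alg_in_QMF QMF_subset_emon_span emon_span_subset_image by auto

end
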